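(* Let $\vartheta$ be an expanding primitive random substitution on a finite alphabet $\mathcal A$, let $\mathbb X_\vartheta$ be its random substitution subshift with Borel $\sigma$-algebra $\mathcal B_\vartheta$ and let $\mu_\vartheta$ be the frequency measure on $(\mathbb X_\vartheta,\mathcal B_\vartheta)$. Then the measure-theoretic dynamical system $(\mathbb X_\vartheta,\mathcal B_\vartheta,\mu_\vartheta)$ is ergodic with respect to the shift $S$, $(Sx)_i=x_{i+1}$.
   Context: Words. $\mathcal A$ is a finite alphabet, $\mathcal A^+=\bigcup_{n\ge 1}\mathcal A^n$ is the set of non-empty finite words, $|u|$ is the length of $u$, $u_{[k,m]}=u_k\cdots u_m$, and $|u|_v$ is the number of (possibly overlapping) occurrences of $v$ as a subword of $u$; $v\triangleleft u$ means $|u|_v\ge 1$. Random substitution. A random substitution $\vartheta$ on $\mathcal A$ is determined by a map $a\mapsto P^\vartheta_a$ assigning to each $a\in\mathcal A$ a finitely supported probability measure on $\mathcal A^+$. The transition kernel is $P(u_1\cdots u_m,v)=\sum_{v^1\cdots v^m=v}P^\vartheta_{u_1}(v^1)\cdots P^\vartheta_{u_m}(v^m)$ (sum over $v^1,\dots,v^m\in\mathcal A^+$ with concatenation $v$). For $u=u_1\cdots u_m\in\mathcal A^+$, $(\vartheta^n(u))_{n\ge 0}$ is the Markov chain on $\mathcal A^+$ with $\vartheta^0(u)=u$ and transition kernel $P$; it is realised on one probability space so that $\vartheta^n(u)=\vartheta^n(u_1)\cdots\vartheta^n(u_m)$ pointwise for all $n$, where $(\vartheta^n(u_1))_n,\dots,(\vartheta^n(u_m))_n$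 are independent Markov chains with kernel $P$ started at the letters $u_1,\dots,u_m$. The mean substitution matrix is $(M_\vartheta)_{ab}=\mathbb E|\vartheta(b)|_a$, $a,b\in\mathcal A$. $\vartheta$ is primitive if $M_\vartheta$ is a primitive matrix; a primitive $\vartheta$ is expanding if $\mathbb P[|\vartheta(a)|>1]>0$ for some $a\in\mathcal A$. Language and subshift. $\mathcal L_\vartheta=\{u\in\mathcal A^+: u\triangleleft v \text{ for some } v \text{ with } \mathbb P[\vartheta^n(a)=v]>0 \text{ for some } n\in\mathbb N, a\in\mathcal A\}$, $\mathcal L_\vartheta^\ell$ is the set of elements of $\mathcal L_\vartheta$ of length $\ell$ (legal words), and $\mathbb X_\vartheta=\{x\in\mathcal A^{\mathbb Z}: x_{[k,m]}\in\mathcal L_\vartheta\text{ for all }k\le m\}$. Induced matrix. For $\ell\in\mathbb N$ let $\mathcal A_\ell=\mathcal L_\vartheta^\ell$. For $u=u_1\cdots u_\ell\in\mathcal A_\ell$ define the random word over the alphabet $\mathcal A_\ell$, $\vartheta_\ell(u)=(\vartheta(u)_{[k,k+\ell-1]})_{1\le k\le|\vartheta(u_1)|}$, and let $(M_{\vartheta_\ell})_{uv}=\mathbb E|\vartheta_\ell(v)|_u$ for $u,v\in\mathcal A_\ell$ (expected number of indices $k$ at which the letter $u\in\mathcal A_\ell$ appears in $\vartheta_\ell(v)$). It is known that for expanding primitive $\vartheta$ the matrix $M_{\vartheta_\ell}$ is primitive with the same Perron–Frobenius eigenvalue $\lambda$ as $M_\vartheta$. $R^{(\ell)}$ denotes its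 right Perron–Frobenius eigenvector with $\|R^{(\ell)}\|_1=1$. Frequency measure. $\mathcal Z_{[k,m]}(v)=\{x\in\mathbb X_\vartheta:x_{[k,m]}=v\}$ for $k\le m$, $v\in\mathcal L_\vartheta^{m-k+1}$. $\mu_\vartheta$ is the unique ($S$-invariant) Borel probability measure on $\mathbb X_\vartheta$ with $\mu_\vartheta(\mathcal Z_{[k,m]}(v))=R^{(m-k+1)}_v$ for all $k\le 0\le m$ and $v\in\mathcal L_\vartheta^{m-k+1}$. *)

theory Defs
  imports "HOL-Probability.Probability" "HOL-Library.Sublist"
begin

section \<open>Matrices indexed by a finite set\<close>

text \<open>
  The induced matrices are indexed by the legal words of a given length, a finite set that is not
  a type.  A matrix is therefore a function of two indices, and the index set is passed explicitly;
  values outside the index set are irrelevant.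
\<close>

primrec mat_power :: "'i set \<Rightarrow> ('i \<Rightarrow> 'i \<Rightarrow> real) \<Rightarrow> nat \<Rightarrow> 'i \<Rightarrow> 'i \<Rightarrow> real" where
  "mat_power I M 0 = (\<lambda>i j. if i = j then 1 else 0)"
| "mat_power I M (Suc n) = (\<lambda>i j. \<Sum>l\<in>I. M i l * mat_power I M n l j)"

definition primitive_matrix :: "'i set \<Rightarrow> ('i \<Rightarrow> 'i \<Rightarrow> real) \<Rightarrow> bool" where
  "primitive_matrix I M \<longleftrightarrow>
     (\<forall>i\<in>I. \<forall>j\<in>I. M i j \<ge> 0) \<and> (\<exists>n\<ge>1. \<forall>i\<in>I. \<forall>j\<in>I. mat_power I M n i j > 0)"

definition matrix_eigenvalue :: "'i set \<Rightarrow> ('i \<Rightarrow> 'i \<Rightarrow> real) \<Rightarrow> complex \<Rightarrow> bool" where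
  "matrix_eigenvalue I M z \<longleftrightarrow>
     (\<exists>x :: 'i \<Rightarrow> complex. (\<exists>i\<in>I. x i \<noteq> 0) \<and>
        (\<forall>i\<in>I. (\<Sum>j\<in>I. complex_of_real (M i j) * x j) = z * x i))"

text \<open>The Perron--Frobenius eigenvalue is an eigenvalue equal to the spectral radius.\<close>

definition pf_eigenvalue :: "'i set \<Rightarrow> ('i \<Rightarrow> 'i \<Rightarrow> real) \<Rightarrow> real \<Rightarrow> bool" where
  "pf_eigenvalue I M l \<longleftrightarrow>
     matrix_eigenvalue I M (complex_of_real l) \<and> (\<forall>z. matrix_eigenvalue I M z \<longrightarrow> cmod z \<le> l)"

definition right_pf_eigenvector :: "'i set \<Rightarrow> ('i \<Rightarrow> 'i \<Rightarrow> real) \<Rightarrow> ('i \<Rightarrow> real) \<Rightarrow> bool" where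
  "right_pf_eigenvector I M r \<longleftrightarrow>
     (\<exists>l. pf_eigenvalue I M l \<and> (\<forall>i\<in>I. (\<Sum>j\<in>I. M i j * r j) = l * r i)) \<and>
     (\<forall>i\<in>I. r i > 0) \<and> (\<Sum>i\<in>I. \<bar>r i\<bar>) = 1"


section \<open>Random substitutions\<close>

definition random_substitution :: "('a::finite \<Rightarrow> 'a list pmf) \<Rightarrow> bool" where
  "random_substitution P \<longleftrightarrow> (\<forall>a. finite (set_pmf (P a)) \<and> [] \<notin> set_pmf (P a))"

text \<open>
  Joint law of the independent images of the letters of a word.  It is needed besides the law of
  their concatenation because the induced substitution refers both to the image of a word and to
  the length of the image of its first letter.
\<close>

primrec letter_images :: "('a \<Rightarrow> 'a list pmf) \<Rightarrow> 'a list \<Rightarrow> 'a list list pmf" where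
  "letter_images P [] = return_pmf []"
| "letter_images P (a # u) =
     bind_pmf (P a) (\<lambda>v. map_pmf (\<lambda>vs. v # vs) (letter_images P u))"

definition rs_kernel :: "('a \<Rightarrow> 'a list pmf) \<Rightarrow> 'a list \<Rightarrow> 'a list pmf" where
  "rs_kernel P u = map_pmf concat (letter_images P u)"

text \<open>The law at time \<open>n\<close> of the Markov chain with this transition kernel started at \<open>u\<close>.\<close>

primrec rs_iter :: "('a \<Rightarrow> 'a list pmf) \<Rightarrow> nat \<Rightarrow> 'a list \<Rightarrow> 'a list pmf" where
  "rs_iter P 0 u = return_pmf u"
| "rs_iter P (Suc n) u = bind_pmf (rs_iter P n u) (rs_kernel P)"

definition mean_matrix :: "('a \<Rightarrow> 'a list pmf) \<Rightarrow> 'a \<Rightarrow> 'a \<Rightarrow> real" where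
  "mean_matrix P a b = measure_pmf.expectation (P b) (\<lambda>w. real (count_list w a))"

definition rs_primitive :: "('a::finite \<Rightarrow> 'a list pmf) \<Rightarrow> bool" where
  "rs_primitive P \<longleftrightarrow> primitive_matrix UNIV (mean_matrix P)"

definition rs_expanding :: "('a \<Rightarrow> 'a list pmf) \<Rightarrow> bool" where
  "rs_expanding P \<longleftrightarrow> (\<exists>a. measure_pmf.prob (P a) {w. length w > 1} > 0)"

text \<open>The transition probabilities of the kernel, written as a sum over factorisations.\<close>

lemma pmf_letter_images:
  "pmf (letter_images P u) vs =
     (if length vs = length u then \<Prod>i<length u. pmf (P (u ! i)) (vs ! i) else 0)"
proof (induction u arbitrary: vs)
  case Nil
  then show ?case by (auto simp: pmf_return)
next
  case (Cons a u)
  show ?case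
  proof (cases vs)
    case Nil
    have "[] \<notin> set_pmf (letter_images P (a # u))" by auto
    then have "pmf (letter_images P (a # u)) [] = 0" by (simp only: set_pmf_iff not_not)
    then show ?thesis using Nil by simp
  next
    case vs: (Cons w ws)
    have "letter_images P (a # u) = map_pmf (\<lambda>(v, vs). v # vs) (pair_pmf (P a) (letter_images P u))"
      by (simp add: pair_pmf_def map_bind_pmf map_pmf_def bind_assoc_pmf bind_return_pmf)
    moreover have "pmf (map_pmf (\<lambda>(v, vs). v # vs) (pair_pmf (P a) (letter_images P u)))
        ((\<lambda>(v, vs). v # vs) (w, ws)) = pmf (pair_pmf (P a) (letter_images P u)) (w, ws)"
      by (rule pmf_map_inj') (auto simp: inj_on_def)
    ultimately have "pmf (letter_images P (a # u)) vs = pmf (P a) w * pmf (letter_images P u) ws"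
      using vs by (simp add: pmf_pair)
    then show ?thesis
      using Cons.IH[of ws] vs by (simp add: prod.lessThan_Suc_shift del: letter_images.simps prod.lessThan_Suc)
  qed
qed

lemma pmf_rs_kernel:
  assumes "random_substitution P"
  shows "pmf (rs_kernel P u) v =
    (\<Sum>vs | length vs = length u \<and> [] \<notin> set vs \<and> concat vs = v.
       \<Prod>i<length u. pmf (P (u ! i)) (vs ! i))"
proof -
  let ?F = "{vs. length vs = length u \<and> [] \<notin> set vs \<and> concat vs = v}"
  have "?F \<subseteq> {vs. set vs \<subseteq> set (sublists v) \<and> length vs = length u}"
  proof safe
    fix vs w assume "w \<in> set vs" "v = concat vs"
    then obtain xs ys where "vs = xs @ w # ys" by (meson split_list)
    then show "w \<in> set (sublists (concat vs))"
      by simp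
  qed
  then have fin: "finite ?F"
    by (rule finite_subset) (rule finite_lists_length_eq, simp)
  have "pmf (rs_kernel P u) v = measure_pmf.prob (letter_images P u) (concat -` {v})"
    unfolding rs_kernel_def by (simp add: pmf_map)
  also have "\<dots> = measure_pmf.prob (letter_images P u) ?F"
  proof (rule measure_prob_cong_0)
    fix vs assume "vs \<in> concat -` {v} - ?F"
    then consider "length vs \<noteq> length u" | "length vs = length u" "[] \<in> set vs" by auto
    then show "pmf (letter_images P u) vs = 0"
    proof cases
      case 1
      then show ?thesis by (simp add: pmf_letter_images)
    next
      case 2
      then obtain i where "i < length u" "vs ! i = []" by (metis in_set_conv_nth)
      moreover have "pmf (P (u ! i)) [] = 0"
        using assms by (simp add: random_substitution_def set_pmf_iff)
      ultimately have "(\<Prod>i<length u. pmf (P (u ! i)) (vs ! i)) = 0"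
        by (metis finite_lessThan lessThan_iff prod_zero)
      then show ?thesis by (simp add: pmf_letter_images)
    qed
  next
    fix vs assume "vs \<in> ?F - concat -` {v}"
    then show "pmf (letter_images P u) vs = 0" by auto
  qed
  also have "\<dots> = (\<Sum>vs\<in>?F. pmf (letter_images P u) vs)"
    using fin by (rule measure_measure_pmf_finite)
  also have "\<dots> = (\<Sum>vs\<in>?F. \<Prod>i<length u. pmf (P (u ! i)) (vs ! i))"
    by (rule sum.cong) (auto simp: pmf_letter_images)
  finally show ?thesis .
qed


section \<open>Language, subshift and induced matrices\<close>

definition language :: "('a \<Rightarrow> 'a list pmf) \<Rightarrow> 'a list set" where
  "language P = {u. u \<noteq> [] \<and> (\<exists>n a v. pmf (rs_iter P n [a]) v > 0 \<and> sublist u v)}"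

definition legal_words :: "('a \<Rightarrow> 'a list pmf) \<Rightarrow> nat \<Rightarrow> 'a list set" where
  "legal_words P l = {u \<in> language P. length u = l}"

definition subshift :: "('a \<Rightarrow> 'a list pmf) \<Rightarrow> (int \<Rightarrow> 'a) set" where
  "subshift P = {x. \<forall>k m. k \<le> m \<longrightarrow> map x [k..m] \<in> language P}"

text \<open>
  The induced word of length-\<open>l\<close> windows, as a function of the images \<open>vs\<close> of the letters of a word
  of length \<open>l \<ge> 1\<close>.  Positions start at 0.  Since images of letters are non-empty, every window
  lies inside \<open>concat vs\<close>, so \<open>take\<close> never truncates.
\<close>

definition induced_word :: "nat \<Rightarrow> 'a list list \<Rightarrow> 'a list list" where
  "induced_word l vs = map (\<lambda>k. take l (drop k (concat vs))) [0..<length (hd vs)]"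

definition induced_matrix :: "('a \<Rightarrow> 'a list pmf) \<Rightarrow> nat \<Rightarrow> 'a list \<Rightarrow> 'a list \<Rightarrow> real" where
  "induced_matrix P l u v =
     measure_pmf.expectation (letter_images P v) (\<lambda>vs. real (count_list (induced_word l vs) u))"


section \<open>The frequency measure and ergodicity\<close>

text \<open>Borel sigma-algebra of the subspace topology inherited from the product of discrete spaces.\<close>

definition subshift_borel :: "('a \<Rightarrow> 'a list pmf) \<Rightarrow> (int \<Rightarrow> 'a) measure" where
  "subshift_borel P = sigma (subshift P)
     {U. openin (subtopology (product_topology (\<lambda>i::int. discrete_topology (UNIV :: 'a set)) UNIV)
                  (subshift P)) U}"

definition cylinder :: "('a \<Rightarrow> 'a list pmf) \<Rightarrow> int \<Rightarrow> int \<Rightarrow> 'a list \<Rightarrow> (int \<Rightarrow> 'a) set" where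
  "cylinder P k m v = {x \<in> subshift P. map x [k..m] = v}"

definition frequency_measure ::
  "('a::finite \<Rightarrow> 'a list pmf) \<Rightarrow> (int \<Rightarrow> 'a) measure \<Rightarrow> bool" where
  "frequency_measure P \<mu> \<longleftrightarrow>
     prob_space \<mu> \<and> sets \<mu> = sets (subshift_borel P) \<and>
     (\<exists>R :: nat \<Rightarrow> 'a list \<Rightarrow> real.
        (\<forall>l\<ge>1. right_pf_eigenvector (legal_words P l) (induced_matrix P l) (R l)) \<and>
        (\<forall>k m v. k \<le> 0 \<longrightarrow> 0 \<le> m \<longrightarrow> v \<in> legal_words P (nat (m - k + 1)) \<longrightarrow>
           measure \<mu> (cylinder P k m v) = R (nat (m - k + 1)) v))"

definition left_shift :: "(int \<Rightarrow> 'a) \<Rightarrow> int \<Rightarrow> 'a" where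
  "left_shift x = (\<lambda>i. x (i + 1))"

text \<open>Ergodicity includes that the transformation preserves the measure.\<close>

definition ergodic :: "'b measure \<Rightarrow> ('b \<Rightarrow> 'b) \<Rightarrow> bool" where
  "ergodic M T \<longleftrightarrow>
     prob_space M \<and> T \<in> M \<rightarrow>\<^sub>M M \<and> distr M M T = M \<and>
     (\<forall>A\<in>sets M. T -` A \<inter> space M = A \<longrightarrow> measure M A = 0 \<or> measure M A = 1)"

end

theory Submission
  imports Defs
begin

text \<open>
  Fix a legal word \<open>v\<close> and \<open>g > R v\<close>.  For large \<open>n\<close> every letter \<open>a\<close> satisfies
  \<open>E |\<theta>\<^sup>n(a)|\<^sub>v + |v| < g E |\<theta>\<^sup>n(a)|\<close>: averaged against the letter frequencies this is the
  eigenvector equation for \<open>\<theta>\<^sup>n\<close>, and the Perron--Frobenius contraction of the mean matrix makes it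
  hold for each letter separately.  So the number of occurrences of \<open>v\<close> minus \<open>g\<close> times the length,
  accumulated along the independent images of the letters of any word, is dominated by a random walk
  with uniformly negative drift, and the maximum of such a walk has bounded expectation.
  Since \<open>\<mu>\<close> is stationary under inflation by \<open>\<theta>\<^sup>n\<close>, the excess of the number of occurrences of \<open>v\<close>
  in \<open>x\<^sub>0\<dots>x\<^sub>N\<^sub>-\<^sub>1\<close> over \<open>g N\<close> has bounded \<open>\<mu>\<close>-expectation.  Dividing by \<open>N\<close> gives
  \<open>\<mu>(A \<inter> Z(v)) \<le> \<mu>(A) \<mu>(Z(v))\<close> for each invariant \<open>A\<close>.  The same bound for the complement
  forces equality, so \<open>A\<close> is independent of all cylinders and hence of itself.
\<close>

section \<open>Expectations over finitely supported distributions\<close>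

abbreviation pexp :: "'b pmf \<Rightarrow> ('b \<Rightarrow> real) \<Rightarrow> real" where
  "pexp \<equiv> measure_pmf.expectation"

lemma pexp_eq_sum:
  assumes "finite (set_pmf p)"
  shows "pexp p f = (\<Sum>x\<in>set_pmf p. pmf p x * f x)"
  using integral_measure_pmf[OF assms, of p f] by simp

lemma pexp_bind:
  assumes "finite (set_pmf p)" "\<And>x. x \<in> set_pmf p \<Longrightarrow> finite (set_pmf (f x))"
  shows "pexp (bind_pmf p f) g = pexp p (\<lambda>x. pexp (f x) g)"
  using pmf_expectation_bind[of "set_pmf p" f p g] assms by (simp add: pexp_eq_sum)

lemma pexp_mono:
  assumes "finite (set_pmf p)" "\<And>x. x \<in> set_pmf p \<Longrightarrow> f x \<le> g x"
  shows "pexp p f \<le> pexp p g"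
  using assms by (auto simp: pexp_eq_sum intro!: sum_mono mult_left_mono)

lemma pexp_cong:
  assumes "\<And>x. x \<in> set_pmf p \<Longrightarrow> f x = g x"
  shows "pexp p f = pexp p g"
  by (rule integral_cong_AE) (auto simp: AE_measure_pmf_iff assms)

lemma pexp_add:
  assumes "finite (set_pmf p)"
  shows "pexp p (\<lambda>x. f x + g x) = pexp p f + pexp p g"
  using assms by (intro Bochner_Integration.integral_add integrable_measure_pmf_finite)

lemma pexp_diff:
  assumes "finite (set_pmf p)"
  shows "pexp p (\<lambda>x. f x - g x) = pexp p f - pexp p g"
  using assms by (intro Bochner_Integration.integral_diff integrable_measure_pmf_finite)

lemma pexp_sum:
  assumes "finite (set_pmf p)"
  shows "pexp p (\<lambda>x. \<Sum>i\<in>I. f i x) = (\<Sum>i\<in>I. pexp p (f i))"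
  using assms by (intro Bochner_Integration.integral_sum integrable_measure_pmf_finite)

lemma pexp_add_const:
  assumes "finite (set_pmf p)"
  shows "pexp p (\<lambda>x. f x + c) = pexp p f + c"
  using pexp_add[OF assms, of f "\<lambda>_. c"] by simp

lemma pexp_const_add:
  assumes "finite (set_pmf p)"
  shows "pexp p (\<lambda>x. c + f x) = c + pexp p f"
  using pexp_add[OF assms, of "\<lambda>_. c" f] by simp

lemma pexp_nonneg:
  assumes "\<And>x. x \<in> set_pmf p \<Longrightarrow> f x \<ge> 0"
  shows "pexp p f \<ge> 0"
  by (rule integral_nonneg_AE) (simp add: AE_measure_pmf_iff assms)

section \<open>Kernels and iterates\<close>

lemma random_substitutionD:
  assumes "random_substitution Q"
  shows "finite (set_pmf (Q a))" "x \<in> set_pmf (Q a) \<Longrightarrow> x \<noteq> []"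
  using assms by (auto simp: random_substitution_def)

lemma finite_set_letter_images [simp]:
  assumes "random_substitution Q"
  shows "finite (set_pmf (letter_images Q w))"
  by (induction w) (auto simp: random_substitutionD[OF assms])

lemma finite_set_rs_kernel [simp]:
  assumes "random_substitution Q"
  shows "finite (set_pmf (rs_kernel Q w))"
  using assms by (simp add: rs_kernel_def)

lemma finite_set_rs_iter [simp]:
  assumes "random_substitution P"
  shows "finite (set_pmf (rs_iter P n w))"
  by (induction n) (auto simp: assms)

lemma rs_kernel_Nil [simp]: "rs_kernel Q [] = return_pmf []"
  by (simp add: rs_kernel_def)

lemma rs_kernel_Cons:
  "rs_kernel Q (a # w) = bind_pmf (Q a) (\<lambda>x. map_pmf ((@) x) (rs_kernel Q w))"
  by (simp add: rs_kernel_def map_bind_pmf map_pmf_comp)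

lemma rs_kernel_append:
  "rs_kernel Q (u @ w) = bind_pmf (rs_kernel Q u) (\<lambda>x. map_pmf ((@) x) (rs_kernel Q w))"
proof (induction u)
  case Nil
  have "(@) [] = (\<lambda>x::'a list. x)" by auto
  then show ?case by (simp add: bind_return_pmf)
next
  case (Cons a u)
  have "(@) (x @ y) = (\<lambda>z. x @ y @ z)" for x y :: "'a list" by auto
  with Cons show ?case
    by (simp add: rs_kernel_Cons map_bind_pmf bind_assoc_pmf map_pmf_comp bind_map_pmf)
qed

lemma length_rs_kernel:
  assumes "random_substitution Q" "y \<in> set_pmf (rs_kernel Q w)"
  shows "length w \<le> length y"
  using assms(2)
proof (induction w arbitrary: y)
  case (Cons a w)
  then obtain x z where "x \<in> set_pmf (Q a)" "z \<in> set_pmf (rs_kernel Q w)" "y = x @ z"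
    by (auto simp: rs_kernel_Cons)
  moreover from this have "length x \<ge> 1"
    using random_substitutionD(2)[OF assms(1)] by (cases x) auto
  ultimately show ?case using Cons.IH by fastforce
qed simp

text \<open>Composing two random substitutions gives a random substitution: the second step
  preserves independence of the images of different letters, so the draws can be regrouped letter by
  letter.\<close>

lemma rs_kernel_bind:
  "rs_kernel (\<lambda>a. bind_pmf (Q a) (rs_kernel P)) w = bind_pmf (rs_kernel Q w) (rs_kernel P)"
proof (induction w)
  case (Cons a w)
  have "rs_kernel (\<lambda>a. bind_pmf (Q a) (rs_kernel P)) (a # w)
      = bind_pmf (Q a) (\<lambda>x. bind_pmf (rs_kernel P x) (\<lambda>x'. bind_pmf (rs_kernel Q w)
          (\<lambda>y. map_pmf ((@) x') (rs_kernel P y))))"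
    by (simp add: rs_kernel_Cons Cons bind_assoc_pmf map_bind_pmf)
  \<comment> \<open>The \<open>P\<close>-image of \<open>x\<close> and the \<open>Q\<close>-image of
    \<open>w\<close> are drawn independently, so their order can be exchanged.\<close>
  also have "\<dots> = bind_pmf (Q a) (\<lambda>x. bind_pmf (rs_kernel Q w) (\<lambda>y. bind_pmf (rs_kernel P x)
          (\<lambda>x'. map_pmf ((@) x') (rs_kernel P y))))"
    by (subst bind_commute_pmf) simp
  also have "\<dots> = bind_pmf (rs_kernel Q (a # w)) (rs_kernel P)"
    by (simp add: rs_kernel_Cons bind_assoc_pmf bind_map_pmf rs_kernel_append)
  finally show ?case .
qed (simp add: bind_return_pmf)

abbreviation rs_pow :: "('a \<Rightarrow> 'a list pmf) \<Rightarrow> nat \<Rightarrow> 'a \<Rightarrow> 'a list pmf" where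
  "rs_pow P n \<equiv> (\<lambda>a. rs_iter P n [a])"

lemma rs_kernel_return: "rs_kernel (\<lambda>a. return_pmf [a]) w = return_pmf w"
  by (induction w) (auto simp: rs_kernel_Cons bind_return_pmf)

text \<open>The branching property. It turns the \<open>n\<close>-th power into a random
  substitution in its own right, to which every result on a single substitution applies.\<close>

lemma rs_iter_eq_kernel: "rs_iter P n w = rs_kernel (rs_pow P n) w"
proof (induction n arbitrary: w)
  case (Suc n)
  have "rs_kernel (rs_pow P (Suc n)) w = bind_pmf (rs_kernel (rs_pow P n) w) (rs_kernel P)"
    by (simp add: rs_kernel_bind)
  then show ?case by (simp add: Suc[symmetric])
qed (simp add: rs_kernel_return)

lemma rs_iter_add: "rs_iter P (m + n) w = bind_pmf (rs_iter P m w) (rs_iter P n)"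
  by (induction n) (simp_all add: bind_return_pmf' bind_assoc_pmf)

lemma length_rs_iter:
  assumes "random_substitution P" "y \<in> set_pmf (rs_iter P n w)"
  shows "length w \<le> length y"
  using assms(2)
proof (induction n arbitrary: y)
  case (Suc n)
  then obtain x where "x \<in> set_pmf (rs_iter P n w)" "y \<in> set_pmf (rs_kernel P x)" by auto
  then show ?case using Suc.IH length_rs_kernel[OF assms(1)] order_trans by blast
qed simp

lemma random_substitution_rs_pow:
  assumes "random_substitution P"
  shows "random_substitution (rs_pow P n)"
  using length_rs_iter[OF assms, of "[]" n] assms
  by (auto simp: random_substitution_def[of "rs_pow P n"] dest: length_rs_iter[OF assms])

section \<open>The induced transfer operator\<close>

definition window_sum :: "nat \<Rightarrow> ('a list \<Rightarrow> real) \<Rightarrow> 'a list \<Rightarrow> 'a list \<Rightarrow> real" where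
  "window_sum N F x y = (\<Sum>k<length x. F (take N (drop k (x @ y))))"

text \<open>The transpose of the induced matrix, acting on functions of windows;
  \<open>sum_induced_matrix\<close> makes this precise. In this form it is composed by conditioning,
  without summing over legal words.\<close>

definition transfer :: "('a \<Rightarrow> 'a list pmf) \<Rightarrow> nat \<Rightarrow> ('a list \<Rightarrow> real) \<Rightarrow> 'a list \<Rightarrow> real" where
  "transfer Q N F w = pexp (Q (hd w)) (\<lambda>x. pexp (rs_kernel Q (tl w)) (window_sum N F x))"

lemma window_sum_append:
  "window_sum N F (x @ x') y = window_sum N F x (x' @ y) + window_sum N F x' y"
proof -
  have "window_sum N F (x @ x') y = (\<Sum>k<length x. F (take N (drop k (x @ x' @ y)))) +
      (\<Sum>k\<in>{length x..<length x + length x'}. F (take N (drop k (x @ x' @ y))))"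
    unfolding window_sum_def
    by (subst sum.union_disjoint[symmetric]) (auto intro!: sum.cong simp del: take_append drop_append)
  also have "(\<Sum>k\<in>{length x..<length x + length x'}. F (take N (drop k (x @ x' @ y)))) =
      window_sum N F x' y"
    unfolding window_sum_def
    by (simp add: sum.atLeastLessThan_shift_0[of _ "length x"] atLeast0LessThan)
  finally show ?thesis by (simp add: window_sum_def)
qed

text \<open>The last window starts at the final letter of \<open>x\<close> and so reads at most
  \<open>N - 1\<close> letters of \<open>y\<close>.\<close>

lemma window_sum_extend:
  assumes "N \<le> Suc (length y)"
  shows "window_sum N F x (y @ z) = window_sum N F x y"
  using assms unfolding window_sum_def by (intro sum.cong) auto

text \<open>Images of letters are non-empty, so the images of the first \<open>N - 1\<close> letters
  after \<open>a\<close> already contain every letter read by windows starting in the image of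
  \<open>a\<close>.\<close>

lemma transfer_truncate:
  assumes "random_substitution P" "N \<ge> 1" "N - 1 \<le> length w"
  shows "transfer P N F (take N (a # w)) = pexp (P a) (\<lambda>x. pexp (rs_kernel P w) (window_sum N F x))"
proof -
  obtain M where N: "N = Suc M" using assms(2) by (cases N) auto
  have *: "pexp (rs_kernel P (take M w)) (window_sum N F x) = pexp (rs_kernel P w) (window_sum N F x)" for x
  proof -
    have split: "rs_kernel P w = bind_pmf (rs_kernel P (take M w))
        (\<lambda>y. map_pmf ((@) y) (rs_kernel P (drop M w)))"
      by (subst rs_kernel_append[symmetric]) simp
    have "pexp (rs_kernel P w) (window_sum N F x) =
        pexp (rs_kernel P (take M w)) (\<lambda>y. pexp (rs_kernel P (drop M w)) (\<lambda>z. window_sum N F x (y @ z)))"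
      by (subst split) (simp add: pexp_bind assms(1))
    also have "\<dots> = pexp (rs_kernel P (take M w)) (\<lambda>y. pexp (rs_kernel P (drop M w)) (\<lambda>z. window_sum N F x y))"
    proof (intro pexp_cong window_sum_extend)
      fix y z assume "y \<in> set_pmf (rs_kernel P (take M w))"
      then show "N \<le> Suc (length y)"
        using length_rs_kernel[OF assms(1), of y "take M w"] assms(3) N by simp
    qed
    finally show ?thesis by simp
  qed
  show ?thesis
    by (simp only: transfer_def N take_Suc_Cons list.sel *[unfolded N])
qed

text \<open>Each letter of \<open>x\<close> is responsible for the windows starting in its own
  image. Peeling off the first letter leaves one value of \<open>transfer\<close>, taken at the
  window of \<open>x @ y\<close> that starts there.\<close>

lemma pexp_window_sum_eq:
  assumes P: "random_substitution P" and N: "N \<ge> 1" "N - 1 \<le> length y"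
  shows "pexp (rs_kernel P x) (\<lambda>x'. pexp (rs_kernel P y) (window_sum N F x'))
    = window_sum N (transfer P N F) x y"
proof (induction x)
  case Nil
  then show ?case by (simp add: window_sum_def)
next
  case (Cons c x)
  have "pexp (rs_kernel P (c # x)) (\<lambda>x'. pexp (rs_kernel P y) (window_sum N F x'))
     = pexp (P c) (\<lambda>x1. pexp (rs_kernel P x) (\<lambda>x2. pexp (rs_kernel P y) (\<lambda>y'.
         window_sum N F x1 (x2 @ y') + window_sum N F x2 y')))"
    by (simp add: rs_kernel_Cons pexp_bind P random_substitutionD[OF P] window_sum_append[abs_def])
  also have "\<dots> = pexp (P c) (\<lambda>x1. pexp (rs_kernel P (x @ y)) (window_sum N F x1))
       + pexp (rs_kernel P x) (\<lambda>x'. pexp (rs_kernel P y) (window_sum N F x'))"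
    by (simp add: pexp_add pexp_add_const P random_substitutionD[OF P] rs_kernel_append pexp_bind)
  also have "pexp (P c) (\<lambda>x1. pexp (rs_kernel P (x @ y)) (window_sum N F x1))
      = transfer P N F (take N (c # x @ y))"
    using N by (subst transfer_truncate[OF P]) auto
  also have "transfer P N F (take N (c # x @ y))
      + pexp (rs_kernel P x) (\<lambda>x'. pexp (rs_kernel P y) (window_sum N F x')) = window_sum N (transfer P N F) (c # x) y"
    by (simp add: Cons window_sum_append[of _ _ "[c]" x, simplified]) (simp add: window_sum_def)
  finally show ?case .
qed

text \<open>Inducing is compatible with composition. This gives the powers of the induced operator
  from \<open>rs_pow\<close> alone.\<close>

lemma transfer_bind:
  assumes P: "random_substitution P" and Q: "random_substitution Q" and N: "N \<ge> 1" and w: "length w = N"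
  shows "transfer (\<lambda>a. bind_pmf (Q a) (rs_kernel P)) N F w = transfer Q N (transfer P N F) w"
proof -
  have "transfer (\<lambda>a. bind_pmf (Q a) (rs_kernel P)) N F w =
     pexp (Q (hd w)) (\<lambda>x. pexp (rs_kernel P x) (\<lambda>x'.
        pexp (bind_pmf (rs_kernel Q (tl w)) (rs_kernel P)) (window_sum N F x')))"
    by (simp add: transfer_def rs_kernel_bind pexp_bind P random_substitutionD[OF Q])
  \<comment> \<open>Collecting the two final words in one pair law allows the independent draws of
    \<open>x'\<close> and \<open>y\<close> to be interchanged.\<close>
  also have "\<dots> = pexp (Q (hd w)) (\<lambda>x. pexp (bind_pmf (rs_kernel P x) (\<lambda>x'. bind_pmf (rs_kernel Q (tl w))
       (\<lambda>y. map_pmf (Pair x') (rs_kernel P y)))) (\<lambda>(x', y'). window_sum N F x' y'))"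
    by (simp add: pexp_bind P Q)
  also have "\<dots> = pexp (Q (hd w)) (\<lambda>x. pexp (bind_pmf (rs_kernel Q (tl w)) (\<lambda>y. bind_pmf (rs_kernel P x)
       (\<lambda>x'. map_pmf (Pair x') (rs_kernel P y)))) (\<lambda>(x', y'). window_sum N F x' y'))"
    by (subst bind_commute_pmf) simp
  also have "\<dots> = pexp (Q (hd w)) (\<lambda>x. pexp (rs_kernel Q (tl w)) (\<lambda>y. pexp (rs_kernel P x)
       (\<lambda>x'. pexp (rs_kernel P y) (window_sum N F x'))))"
    by (simp add: pexp_bind P Q)
  also have "\<dots> = transfer Q N (transfer P N F) w"
  proof -
    have "N - 1 \<le> length y" if "y \<in> set_pmf (rs_kernel Q (tl w))" for y
      using length_rs_kernel[OF Q that] w by simp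
    then show ?thesis
      unfolding transfer_def[of Q] by (intro pexp_cong pexp_window_sum_eq[OF P N])
  qed
  finally show ?thesis .
qed

section \<open>Occurrences of a word\<close>

text \<open>A window cut off by the end of \<open>u\<close> is shorter than \<open>v\<close> and is
  not counted. For \<open>v \<noteq> []\<close> this is therefore the usual number of occurrences,
  overlaps included.\<close>

definition occ :: "'a list \<Rightarrow> 'a list \<Rightarrow> nat" where
  "occ v u = card {i\<in>{..<length u}. take (length v) (drop i u) = v}"

lemma occ_Nil [simp]: "occ v [] = 0"
  by (simp add: occ_def)

lemma occ_append_left: "occ v x \<le> occ v (x @ y)"
  unfolding occ_def
proof (rule card_mono)
  show "{i \<in> {..<length x}. take (length v) (drop i x) = v}
      \<subseteq> {i \<in> {..<length (x @ y)}. take (length v) (drop i (x @ y)) = v}"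
  proof safe
    fix i assume *: "i < length x" "take (length v) (drop i x) = v"
    have "length (take (length v) (drop i x)) = length v" by (simp only: *)
    then have "i + length v \<le> length x" using *(1) by auto
    then show "take (length v) (drop i (x @ y)) = v" using * by simp
  qed simp
qed simp

lemma occ_append_right: "occ v y \<le> occ v (x @ y)"
  unfolding occ_def
  by (rule card_inj_on_le[of "\<lambda>i. i + length x"]) (auto simp: inj_on_def)

text \<open>An occurrence straddling the join starts among the last \<open>length v\<close>
  positions of \<open>x\<close>.\<close>

lemma occ_append: "occ v (x @ y) \<le> occ v x + length v + occ v y"
proof -
  let ?S = "\<lambda>u. {i\<in>{..<length u}. take (length v) (drop i u) = v}"
  have "?S (x @ y) \<subseteq> ?S x \<union> {length x - length v..<length x} \<union> (\<lambda>i. i + length x) ` ?S y"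
  proof
    fix i assume i: "i \<in> ?S (x @ y)"
    consider "i + length v \<le> length x" "i < length x" | "length x < i + length v" "i < length x" | "length x \<le> i"
      by linarith
    then show "i \<in> ?S x \<union> {length x - length v..<length x} \<union> (\<lambda>i. i + length x) ` ?S y"
    proof cases
      case 3
      then have "i - length x \<in> ?S y" "i = (i - length x) + length x" using i by auto
      then show ?thesis by blast
    qed (use i in auto)
  qed
  then have "card (?S (x @ y)) \<le> card (?S x \<union> {length x - length v..<length x} \<union> (\<lambda>i. i + length x) ` ?S y)"
    by (intro card_mono) auto
  also have "\<dots> \<le> card (?S x) + card {length x - length v..<length x} + card ((\<lambda>i. i + length x) ` ?S y)"
    by (meson card_Un_le add_le_mono order_trans order_refl)
  also have "\<dots> \<le> card (?S x) + length v + card (?S y)"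
    by (intro add_mono card_image_le) auto
  finally show ?thesis by (simp add: occ_def)
qed

lemma occ_take_drop: "occ v (take n (drop k u)) \<le> occ v (take (k + n) u)"
proof -
  have "take (k + n) u = take k u @ take n (drop k u)" by (rule take_add)
  then show ?thesis by (simp only: occ_append_right)
qed

lemma occ_take: "occ v (take n u) \<le> occ v u"
  using occ_append_left[of v "take n u" "drop n u"] by simp

text \<open>The term \<open>length v\<close> pays for the occurrences straddling a join; it is what
  makes the excess subadditive under concatenation.\<close>

definition excess :: "'a list \<Rightarrow> real \<Rightarrow> 'a list \<Rightarrow> real" where
  "excess v g u = real (occ v u) + real (length v) - g * real (length u)"

lemma excess_append: "excess v g (x @ y) \<le> excess v g x + excess v g y"
  using occ_append[of v x y] by (simp add: excess_def algebra_simps)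

section \<open>Random walks with negative drift\<close>

text \<open>The sum of \<open>exp (t S\<^sub>j)\<close> over all partial sums \<open>S\<^sub>j\<close> of \<open>z\<close> along the list.\<close>

primrec walk_sum :: "('b \<Rightarrow> real) \<Rightarrow> real \<Rightarrow> 'b list \<Rightarrow> real" where
  "walk_sum z t [] = 1"
| "walk_sum z t (x # xs) = 1 + exp (t * z x) * walk_sum z t xs"

lemma walk_sum_ge_1: "walk_sum z t xs \<ge> 1"
  by (induction xs) auto

text \<open>The cut after \<open>M\<close> letters falls into some block. By subadditivity the count
  is controlled by the partial sum of the walk up to and including that block, and the missing part
  of the block costs at most \<open>g * C\<close>. The exponential of \<open>t\<close> times each
  partial sum is a summand of \<open>walk_sum\<close>, so its logarithm dominates them all at once,
  whatever \<open>M\<close> is.\<close>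

lemma occ_take_concat_le:
  assumes "g \<ge> 0" "t > 0" "\<And>x. x \<in> set xs \<Longrightarrow> length x \<le> C"
  shows "t * (real (occ v (take M (concat xs))) - g * real M - g * real C) \<le> ln (walk_sum (excess v g) t xs)"
  using assms(3)
proof (induction xs arbitrary: M)
  case Nil
  have "- (g * real M) - g * real C \<le> 0"
    using mult_nonneg_nonneg[OF assms(1), of "real M"] mult_nonneg_nonneg[OF assms(1), of "real C"] by linarith
  then show ?case using assms by (simp add: mult_nonneg_nonpos)
next
  case (Cons x xs)
  let ?W = "walk_sum (excess v g) t"
  have W: "?W xs \<ge> 1" by (rule walk_sum_ge_1)
  \<comment> \<open>Shifting the remaining walk by its first step loses only the summand 1 of the
    empty partial sum.\<close>
  have "t * excess v g x + ln (?W xs) = ln (exp (t * excess v g x) * ?W xs)"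
    using W by (simp add: ln_mult)
  also have "\<dots> \<le> ln (?W (x # xs))" using W by (subst ln_le_cancel_iff) (auto intro: add_pos_nonneg)
  finally have *: "t * excess v g x + ln (?W xs) \<le> ln (?W (x # xs))" .
  show ?case
  proof (cases "M \<le> length x")
    case True
    have "real (occ v (take M (concat (x # xs)))) \<le> real (occ v x)"
      using True by (simp add: occ_take)
    also have "\<dots> \<le> excess v g x + g * real (length x)" by (simp add: excess_def)
    also have "\<dots> \<le> excess v g x + g * real C"
      using Cons.prems assms by (auto intro!: mult_left_mono)
    finally have "real (occ v (take M (concat (x # xs)))) - g * real M - g * real C \<le> excess v g x"
      using mult_nonneg_nonneg[OF assms(1), of "real M"] by linarith
    then have "t * (real (occ v (take M (concat (x # xs)))) - g * real M - g * real C) \<le> t * excess v g x"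
      using assms by (intro mult_left_mono) auto
    also have "\<dots> \<le> t * excess v g x + ln (?W xs)" using W by simp
    finally show ?thesis using * by linarith
  next
    case False
    let ?r = "take (M - length x) (concat xs)"
    have "real (occ v (take M (concat (x # xs)))) \<le> real (occ v x) + length v + occ v ?r"
      using False occ_append[of v x ?r] by simp
    also have "\<dots> = excess v g x + g * real (length x) + occ v ?r" by (simp add: excess_def)
    finally have "real (occ v (take M (concat (x # xs)))) - g * real M - g * real C
       \<le> excess v g x + (real (occ v ?r) - g * real (M - length x) - g * real C)"
      using False by (simp add: algebra_simps of_nat_diff)
    then have "t * (real (occ v (take M (concat (x # xs)))) - g * real M - g * real C)
       \<le> t * (excess v g x + (real (occ v ?r) - g * real (M - length x) - g * real C))"
      using assms by (intro mult_left_mono) auto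
    also have "\<dots> \<le> t * excess v g x + ln (?W xs)"
      using Cons.IH[of "M - length x"] Cons.prems by (simp add: distrib_left)
    finally show ?thesis using * by linarith
  qed
qed

text \<open>By independence the expectation obeys the recursion of a geometric series, and
  \<open>1 / (1 - \<rho>)\<close> is the fixed point of \<open>s = 1 + \<rho> * s\<close>. The point
  is that the bound does not depend on \<open>w\<close>.\<close>

lemma pexp_walk_sum_le:
  assumes Q: "random_substitution Q" and \<rho>: "0 \<le> \<rho>" "\<rho> < 1"
    and le: "\<And>a. pexp (Q a) (\<lambda>x. exp (t * z x)) \<le> \<rho>"
  shows "pexp (letter_images Q w) (walk_sum z t) \<le> 1 / (1 - \<rho>)"
proof (induction w)
  case Nil
  then show ?case using \<rho> by simp
next
  case (Cons a w)
  have "pexp (letter_images Q (a # w)) (walk_sum z t)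
     = pexp (Q a) (\<lambda>x. 1 + exp (t * z x) * pexp (letter_images Q w) (walk_sum z t))"
    by (simp add: pexp_bind random_substitutionD[OF Q] Q pexp_const_add)
  also have "\<dots> = 1 + pexp (Q a) (\<lambda>x. exp (t * z x)) * pexp (letter_images Q w) (walk_sum z t)"
    by (simp add: pexp_const_add random_substitutionD[OF Q])
  also have "\<dots> \<le> 1 + \<rho> * (1 / (1 - \<rho>))"
    using walk_sum_ge_1[of z t]
    by (intro add_left_mono mult_mono le Cons \<rho>) (auto intro!: pexp_nonneg intro: order_trans[OF zero_le_one])
  also have "\<dots> = 1 / (1 - \<rho>)" using \<rho> by (simp add: field_simps)
  finally show ?case .
qed

text \<open>The moment generating function equals 1 at 0, and its derivative there is the negative
  mean.\<close>

lemma exp_moment_lt_1: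
  assumes fin: "finite (set_pmf p)" and neg: "pexp p z < 0"
  shows "\<exists>d>0. \<forall>t. 0 < t \<and> t < d \<longrightarrow> pexp p (\<lambda>x. exp (t * z x)) < 1"
proof -
  let ?f = "\<lambda>t. \<Sum>x\<in>set_pmf p. pmf p x * exp (t * z x)"
  have "(?f has_real_derivative (\<Sum>x\<in>set_pmf p. pmf p x * z x)) (at 0)"
    by (auto intro!: derivative_eq_intros sum.cong)
  from DERIV_neg_dec_right[OF this] neg
  obtain d where d: "d > 0" "\<And>h. h > 0 \<Longrightarrow> h < d \<Longrightarrow> ?f (0 + h) < ?f 0"
    by (auto simp only: pexp_eq_sum[OF fin])
  have "?f 0 = 1" using fin by (simp add: sum_pmf_eq_1)
  with d show ?thesis by (auto simp: pexp_eq_sum[OF fin])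
qed

lemma uniform_exp_moment:
  fixes Q :: "'a::finite \<Rightarrow> 'a list pmf"
  assumes Q: "random_substitution Q" and neg: "\<And>a. pexp (Q a) z < 0"
  obtains t \<rho> where "t > 0" "0 \<le> \<rho>" "\<rho> < 1" "\<And>a. pexp (Q a) (\<lambda>x. exp (t * z x)) \<le> \<rho>"
proof -
  have "\<forall>a. \<exists>d>0. \<forall>t. 0 < t \<and> t < d \<longrightarrow> pexp (Q a) (\<lambda>x. exp (t * z x)) < 1"
    using exp_moment_lt_1 neg random_substitutionD(1)[OF Q] by blast
  then obtain d where d: "\<And>a. d a > (0::real)"
    "\<And>a t. 0 < t \<Longrightarrow> t < d a \<Longrightarrow> pexp (Q a) (\<lambda>x. exp (t * z x)) < 1" by metis
  \<comment> \<open>Finiteness of the alphabet gives one exponent that works for all letters;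
    halving keeps it strictly below each \<open>d a\<close>.\<close>
  define t where "t = Min (range d) / 2"
  have pos: "Min (range d) > 0" using d by simp
  have "Min (range d) \<le> d a" for a by simp
  then have t: "t > 0" "t < d a" for a
    using pos unfolding t_def by (linarith, smt (verit) field_sum_of_halves)
  define \<rho> where "\<rho> = Max (range (\<lambda>a. pexp (Q a) (\<lambda>x. exp (t * z x))))"
  have le: "pexp (Q a) (\<lambda>x. exp (t * z x)) \<le> \<rho>" for a by (simp add: \<rho>_def)
  \<comment> \<open>\<open>undefined\<close> stands for an arbitrary letter: one nonnegative value
    makes the maximum nonnegative.\<close>
  have "0 \<le> pexp (Q undefined) (\<lambda>x. exp (t * z x))" by (intro pexp_nonneg) simp
  then have "0 \<le> \<rho>" using le order_trans by blast
  moreover have "\<rho> < 1" unfolding \<rho>_def using d(2) t by (subst Max_less_iff) auto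
  ultimately show ?thesis using that t le by blast
qed

section \<open>Additive functionals and the mean matrix\<close>

text \<open>The empty word is excluded because a subadditive functional may be positive there;
  \<open>excess v g []\<close> is \<open>length v\<close>.\<close>

lemma pexp_rs_kernel_subadditive:
  assumes Q: "random_substitution Q" and z: "\<And>x y. z (x @ y) \<le> z x + z y" and "w \<noteq> []"
  shows "pexp (rs_kernel Q w) z \<le> (\<Sum>b\<leftarrow>w. pexp (Q b) z)"
  using assms(3)
proof (induction w rule: list_nonempty_induct)
  case (single a)
  then show ?case by (simp add: rs_kernel_Cons bind_return_pmf')
next
  case (cons a w)
  have "pexp (rs_kernel Q (a # w)) z = pexp (Q a) (\<lambda>x. pexp (rs_kernel Q w) (\<lambda>y. z (x @ y)))"
    by (simp add: rs_kernel_Cons pexp_bind Q random_substitutionD[OF Q])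
  also have "\<dots> \<le> pexp (Q a) (\<lambda>x. pexp (rs_kernel Q w) (\<lambda>y. z x + z y))"
    by (intro pexp_mono z) (auto simp: Q random_substitutionD[OF Q])
  also have "\<dots> = pexp (Q a) z + pexp (rs_kernel Q w) z"
    by (simp add: pexp_const_add pexp_add_const Q random_substitutionD[OF Q])
  finally show ?case using cons by simp
qed

lemma pexp_rs_kernel_additive:
  assumes Q: "random_substitution Q"
  shows "pexp (rs_kernel Q w) (\<lambda>y. \<Sum>b\<leftarrow>y. g b) = (\<Sum>a\<leftarrow>w. pexp (Q a) (\<lambda>y. \<Sum>b\<leftarrow>y. g b))"
  by (induction w)
    (simp_all add: rs_kernel_Cons pexp_bind Q random_substitutionD[OF Q] pexp_const_add pexp_add_const)

lemma sum_list_eq_sum_count: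
  fixes g :: "'b \<Rightarrow> real"
  assumes "finite S" "set w \<subseteq> S"
  shows "(\<Sum>b\<leftarrow>w. g b) = (\<Sum>b\<in>S. real (count_list w b) * g b)"
  using assms(2)
proof (induction w)
  case (Cons a w)
  have "(\<Sum>b\<in>S. real (count_list (a # w) b) * g b)
     = (\<Sum>b\<in>S. (if a = b then g b else 0) + real (count_list w b) * g b)"
    by (intro sum.cong) (auto simp: distrib_right)
  then show ?case using Cons assms(1) by (simp add: sum.distrib)
qed simp

lemma pexp_additive:
  fixes P :: "'a::finite \<Rightarrow> 'a list pmf"
  assumes "random_substitution P"
  shows "pexp (P a) (\<lambda>w. \<Sum>b\<leftarrow>w. g b) = (\<Sum>b\<in>UNIV. mean_matrix P b a * g b)"
  by (simp add: sum_list_eq_sum_count[of UNIV] pexp_sum mean_matrix_def random_substitutionD[OF assms])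

text \<open>Powers of the mean matrix give expected letter counts of powers of the substitution. The
  last substitution step is absorbed into the functional, which is why the induction generalises
  over \<open>g\<close>.\<close>

lemma pexp_rs_pow_additive:
  fixes P :: "'a::finite \<Rightarrow> 'a list pmf"
  assumes P: "random_substitution P"
  shows "pexp (rs_iter P n [a]) (\<lambda>w. \<Sum>b\<leftarrow>w. g b) = (\<Sum>b\<in>UNIV. mat_power UNIV (mean_matrix P) n b a * g b)"
proof (induction n arbitrary: g)
  case (Suc n)
  have "pexp (rs_iter P (Suc n) [a]) (\<lambda>w. \<Sum>b\<leftarrow>w. g b)
     = pexp (rs_iter P n [a]) (\<lambda>w. \<Sum>c\<leftarrow>w. \<Sum>b\<in>UNIV. mean_matrix P b c * g b)"
    by (simp add: pexp_bind P pexp_rs_kernel_additive pexp_additive)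
  also have "\<dots> = (\<Sum>c\<in>UNIV. mat_power UNIV (mean_matrix P) n c a * (\<Sum>b\<in>UNIV. mean_matrix P b c * g b))"
    by (rule Suc)
  also have "\<dots> = (\<Sum>b\<in>UNIV. mat_power UNIV (mean_matrix P) (Suc n) b a * g b)"
    by (simp add: sum_distrib_left sum_distrib_right mult_ac) (rule sum.swap)
  finally show ?case .
qed (simp add: if_distrib[of "\<lambda>c. c * _"] cong: if_cong)

lemma mat_power_eigenvector:
  assumes "\<And>i. i \<in> I \<Longrightarrow> (\<Sum>j\<in>I. M i j * r j) = l * r i" "finite I" "i \<in> I"
  shows "(\<Sum>j\<in>I. mat_power I M n i j * r j) = l ^ n * r i"
  using assms(3)
proof (induction n arbitrary: i)
  case 0
  then show ?case using assms(2) by (simp add: if_distrib[of "\<lambda>c. c * _"] cong: if_cong)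
next
  case (Suc n)
  have "(\<Sum>j\<in>I. mat_power I M (Suc n) i j * r j) = (\<Sum>k\<in>I. M i k * (\<Sum>j\<in>I. mat_power I M n k j * r j))"
    by (simp add: sum_distrib_left sum_distrib_right mult_ac) (rule sum.swap)
  also have "\<dots> = (\<Sum>k\<in>I. M i k * (l ^ n * r k))" using Suc by simp
  also have "\<dots> = l ^ n * (\<Sum>k\<in>I. M i k * r k)" by (simp add: sum_distrib_left mult_ac)
  finally show ?case using assms(1)[OF Suc.prems] by simp
qed

section \<open>A contraction for positive matrices\<close>

text \<open>The weight of the positive part of \<open>W n\<close> is smaller than that of the negative part, so after
  multiplication by \<open>K\<close> a fixed proportion of it cancels.  It hence grows at a smaller rate than
  the total weight, which is negative.\<close>

lemma positive_matrix_negative_drift: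
  fixes K :: "'a::finite \<Rightarrow> 'a \<Rightarrow> real" and W :: "nat \<Rightarrow> 'a \<Rightarrow> real"
  assumes K: "\<And>b a. K b a > 0" and r: "\<And>b. r b > 0" "(\<Sum>b\<in>UNIV. r b) = 1"
    and eig: "\<And>b. (\<Sum>a\<in>UNIV. K b a * r a) = L * r b"
    and W: "\<And>n a. W (Suc n) a = (\<Sum>b\<in>UNIV. K b a * W n b)"
    and neg: "(\<Sum>b\<in>UNIV. r b * W 0 b) < 0"
  shows "\<exists>n. \<forall>a. W n a < 0"
proof -
  define s where "s n = (\<Sum>b\<in>UNIV. r b * max 0 (W n b))" for n
  define c where "c = - (\<Sum>b\<in>UNIV. r b * W 0 b)"
  have c: "c > 0" using neg by (simp add: c_def)
  have "(\<Sum>a\<in>UNIV. K b a * r a) > 0" for b using K r by (intro sum_pos) auto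
  then have L: "L > 0" using eig r by (metis zero_less_mult_pos2)
  have s0: "s n \<ge> 0" for n unfolding s_def using r by (intro sum_nonneg) (simp add: less_imp_le)
  \<comment> \<open>\<open>W\<close> evolves under the transpose of \<open>K\<close>, so pairing
    with the right eigenvector \<open>r\<close> merely multiplies by \<open>L\<close>.\<close>
  have dual: "(\<Sum>a\<in>UNIV. r a * (\<Sum>b\<in>UNIV. K b a * f b)) = L * (\<Sum>b\<in>UNIV. r b * f b)" for f
  proof -
    have "(\<Sum>a\<in>UNIV. r a * (\<Sum>b\<in>UNIV. K b a * f b)) = (\<Sum>b\<in>UNIV. (\<Sum>a\<in>UNIV. K b a * r a) * f b)"
      by (simp add: sum_distrib_left sum_distrib_right mult_ac) (rule sum.swap)
    also have "\<dots> = L * (\<Sum>b\<in>UNIV. r b * f b)"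
      by (simp only: eig) (simp add: sum_distrib_left mult_ac)
    finally show ?thesis .
  qed
  have total: "(\<Sum>b\<in>UNIV. r b * W n b) = - c * L ^ n" for n
    by (induction n) (simp_all add: W dual c_def)
  have minus: "(\<Sum>b\<in>UNIV. r b * max 0 (- W n b)) = s n + c * L ^ n" for n
  proof -
    have "(\<Sum>b\<in>UNIV. r b * max 0 (- W n b)) = (\<Sum>b\<in>UNIV. r b * max 0 (W n b) - r b * W n b)"
      by (intro sum.cong refl) (auto simp: max_def algebra_simps)
    then show ?thesis by (simp add: sum_subtractf total s_def)
  qed
  \<comment> \<open>With these constants every column of \<open>K\<close> lies entrywise between
    \<open>\<delta> * L\<close> and \<open>D * L\<close> times \<open>r\<close>;
    \<open>\<delta>\<close> is the proportion that cancels in each step.\<close>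
  define \<delta> where "\<delta> = Min (range (\<lambda>(a, b). K b a / (L * r b)))"
  define D where "D = Max (range (\<lambda>(a, b). K b a / (L * r b)))"
  have "\<delta> \<le> K b a / (L * r b)" for a b
    unfolding \<delta>_def by (rule Min_le) (auto intro!: image_eqI[of _ _ "(a, b)"])
  then have \<delta>_le: "\<delta> * L * r b \<le> K b a" for a b
    using L r by (simp add: le_divide_eq mult.assoc)
  have "K b a / (L * r b) \<le> D" for a b
    unfolding D_def by (rule Max_ge) (auto intro!: image_eqI[of _ _ "(a, b)"])
  then have D_ge: "K b a \<le> D * L * r b" for a b
    using L r by (simp add: divide_le_eq mult.assoc)
  have \<delta>: "\<delta> > 0" unfolding \<delta>_def using K L r by (subst Min_gr_iff) auto
  have D: "D > 0" using D_ge[of undefined undefined] K[of undefined undefined] L r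
    by (metis less_le_trans zero_less_mult_pos2)
  \<comment> \<open>Averaging the lower bound on \<open>K\<close> over the columns with weights
    \<open>r\<close> compares \<open>\<delta> * L * r b\<close> with \<open>L * r b\<close>.\<close>
  have \<delta>1: "\<delta> \<le> 1"
  proof -
    fix b
    have "\<delta> * L * r b = (\<Sum>a\<in>UNIV. (\<delta> * L * r b) * r a)"
      using r by (simp add: sum_distrib_left[symmetric])
    also have "\<dots> \<le> (\<Sum>a\<in>UNIV. K b a * r a)"
      using r \<delta>_le by (intro sum_mono mult_right_mono) (auto simp: less_imp_le)
    finally show ?thesis using eig[of b] L r(1)[of b] by simp
  qed
  have lower: "\<delta> * L * (\<Sum>b\<in>UNIV. r b * f b) \<le> (\<Sum>b\<in>UNIV. K b a * f b)"
    if "\<And>b. f b \<ge> 0" for f a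
    unfolding sum_distrib_left using that \<delta>_le
    by (intro sum_mono) (simp add: mult.assoc[symmetric] mult_right_mono)
  have upper: "(\<Sum>b\<in>UNIV. K b a * f b) \<le> D * L * (\<Sum>b\<in>UNIV. r b * f b)"
    if "\<And>b. f b \<ge> 0" for f a
    unfolding sum_distrib_left using that D_ge
    by (intro sum_mono) (simp add: mult.assoc[symmetric] mult_right_mono)
  have split: "W (Suc n) a \<le> (\<Sum>b\<in>UNIV. K b a * max 0 (W n b)) - \<delta> * L * (s n + c * L ^ n)" for n a
  proof -
    have "W (Suc n) a = (\<Sum>b\<in>UNIV. K b a * max 0 (W n b) - K b a * max 0 (- W n b))"
      unfolding W by (intro sum.cong refl) (auto simp: max_def algebra_simps)
    then show ?thesis
      using lower[of "\<lambda>b. max 0 (- W n b)" a] by (simp add: sum_subtractf minus)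
  qed
  have step: "s (Suc n) \<le> (1 - \<delta>) * L * s n" for n
  proof -
    \<comment> \<open>The bound from \<open>split\<close> survives taking the positive part, because
      \<open>lower\<close> applied to the positive part of \<open>W n\<close> shows its right side
      to be nonnegative.\<close>
    have "max 0 (W (Suc n) a) \<le> (\<Sum>b\<in>UNIV. K b a * max 0 (W n b)) - \<delta> * L * s n" for a
    proof -
      have "0 \<le> \<delta> * L * (c * L ^ n)" using \<delta> L c by simp
      then show ?thesis
        using split[of n a] lower[of "\<lambda>b. max 0 (W n b)" a] by (simp add: s_def distrib_left)
    qed
    then have "s (Suc n) \<le> (\<Sum>a\<in>UNIV. r a * ((\<Sum>b\<in>UNIV. K b a * max 0 (W n b)) - \<delta> * L * s n))"
      unfolding s_def[of "Suc n"] using r by (intro sum_mono mult_left_mono) (auto simp: less_imp_le)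
    also have "\<dots> = L * s n - \<delta> * L * s n"
      using r(2) by (simp add: right_diff_distrib sum_subtractf dual s_def[symmetric] sum_distrib_right[symmetric])
    finally show ?thesis by (simp add: algebra_simps)
  qed
  have s_le: "s n \<le> ((1 - \<delta>) * L) ^ n * s 0" for n
  proof (induction n)
    case (Suc n)
    have "s (Suc n) \<le> (1 - \<delta>) * L * s n" by (rule step)
    also have "\<dots> \<le> (1 - \<delta>) * L * (((1 - \<delta>) * L) ^ n * s 0)"
      using \<delta>1 L Suc by (intro mult_left_mono) auto
    finally show ?case by (simp add: mult_ac)
  qed simp
  \<comment> \<open>After division by powers of \<open>L\<close> the positive part decays
    geometrically while the negative drift keeps size \<open>\<delta> * c\<close>. The summand 1
    guards against \<open>s 0 = 0\<close>.\<close>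
  obtain n where n: "(1 - \<delta>) ^ n < \<delta> * c / (D * s 0 + 1)"
    using real_arch_pow_inv[of "\<delta> * c / (D * s 0 + 1)" "1 - \<delta>"] \<delta> c D s0[of 0]
    by (auto simp: add_nonneg_pos)
  have "W (Suc n) a < 0" for a
  proof -
    have "(1 - \<delta>) ^ n * (D * s 0 + 1) < \<delta> * c"
      using n D s0[of 0] by (simp add: less_divide_eq add_nonneg_pos)
    moreover have "0 \<le> (1 - \<delta>) ^ n" using \<delta>1 by simp
    ultimately have n': "D * ((1 - \<delta>) ^ n * s 0) < \<delta> * c" by (simp add: algebra_simps)
    have "W (Suc n) a \<le> D * L * s n - \<delta> * L * (s n + c * L ^ n)"
      using split[of n a] upper[of "\<lambda>b. max 0 (W n b)" a] by (simp add: s_def)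
    also have "\<dots> \<le> D * L * s n - \<delta> * L * (c * L ^ n)"
      using \<delta> L s0[of n] by (simp add: distrib_left)
    also have "\<dots> \<le> D * L * (((1 - \<delta>) * L) ^ n * s 0) - \<delta> * L * (c * L ^ n)"
      using s_le[of n] D L by (simp add: mult_left_mono)
    also have "\<dots> = L * L ^ n * (D * ((1 - \<delta>) ^ n * s 0) - \<delta> * c)"
      by (simp only: power_mult_distrib) (simp add: algebra_simps)
    also have "\<dots> < 0" using n' L by (simp add: mult_pos_neg)
    finally show ?thesis .
  qed
  then show ?thesis by blast
qed

section \<open>Legal words\<close>

lemma language_sublist:
  assumes "u \<in> language P" "sublist w u" "w \<noteq> []"
  shows "w \<in> language P"
  using assms by (auto simp: language_def) (metis sublist_order.order_trans)

lemma singleton_in_language: "[a] \<in> language P"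
proof -
  have "pmf (rs_iter P 0 [a]) [a] > 0" by simp
  then show ?thesis unfolding language_def by blast
qed

text \<open>A realisation containing \<open>u\<close> is substituted once more, with arbitrary
  images for the letters around \<open>u\<close>.\<close>

lemma language_rs_kernel:
  assumes P: "random_substitution P" and u: "u \<in> language P" and y: "y \<in> set_pmf (rs_kernel P u)"
  shows "y \<in> language P"
proof -
  obtain n a p s where v: "p @ u @ s \<in> set_pmf (rs_iter P n [a])" and "u \<noteq> []"
    using u by (auto simp: language_def sublist_def pmf_positive_iff)
  obtain p' s' where ps: "p' \<in> set_pmf (rs_kernel P p)" "s' \<in> set_pmf (rs_kernel P s)"
    using set_pmf_not_empty by fastforce
  have "p' @ y @ s' \<in> set_pmf (rs_kernel P (p @ u @ s))"
    using ps y by (auto simp: rs_kernel_append)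
  then have "p' @ y @ s' \<in> set_pmf (rs_iter P (Suc n) [a])" using v by auto
  then have "pmf (rs_iter P (Suc n) [a]) (p' @ y @ s') > 0" by (simp only: pmf_positive_iff)
  moreover have "y \<noteq> []" using length_rs_kernel[OF P y] \<open>u \<noteq> []\<close> by auto
  ultimately show ?thesis unfolding language_def by blast
qed

lemma finite_legal_words [simp]: "finite (legal_words P l)" for P :: "'a::finite \<Rightarrow> 'a list pmf"
  using finite_lists_length_eq[of "UNIV :: 'a set" l]
  by (rule rev_finite_subset) (auto simp: legal_words_def)

lemma window_legal:
  assumes P: "random_substitution P" and w: "w \<in> legal_words P l" and l: "l \<ge> 1"
    and x: "x \<in> set_pmf (P (hd w))" and y: "y \<in> set_pmf (rs_kernel P (tl w))" and k: "k < length x"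
  shows "take l (drop k (x @ y)) \<in> legal_words P l"
proof -
  have w': "w \<noteq> []" "w \<in> language P" "length w = l" using w l by (auto simp: legal_words_def)
  have "x @ y \<in> set_pmf (rs_kernel P (hd w # tl w))"
    using x y by (auto simp: rs_kernel_Cons)
  then have "x @ y \<in> language P"
    using w' language_rs_kernel[OF P] by simp
  moreover have "length (take l (drop k (x @ y))) = l"
    using length_rs_kernel[OF P y] w' k l by simp
  moreover have "sublist (take l (drop k (x @ y))) (x @ y)"
    by (meson sublist_drop sublist_order.order_trans sublist_take)
  ultimately show ?thesis
    using language_sublist[of "x @ y" P "take l (drop k (x @ y))"] l by (fastforce simp: legal_words_def)
qed

text \<open>All entries of the induced word are legal by \<open>window_legal\<close>, so summing
  over legal words counts every window.\<close>

lemma sum_induced_matrix: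
  fixes P :: "'a::finite \<Rightarrow> 'a list pmf"
  assumes P: "random_substitution P" and w: "w \<in> legal_words P l" and l: "l \<ge> 1"
  shows "(\<Sum>u\<in>legal_words P l. F u * induced_matrix P l u w) = transfer P l F w"
proof -
  obtain a w' where w': "w = a # w'" using w l by (cases w) (auto simp: legal_words_def)
  have ind: "induced_word l (x # vs) = map (\<lambda>k. take l (drop k (x @ concat vs))) [0..<length x]" for x and vs :: "'a list list"
    by (simp add: induced_word_def)
  have "(\<Sum>u\<in>legal_words P l. F u * induced_matrix P l u w)
     = pexp (letter_images P w) (\<lambda>vs. \<Sum>u\<in>legal_words P l. real (count_list (induced_word l vs) u) * F u)"
    by (simp add: induced_matrix_def pexp_sum P mult.commute)
  also have "\<dots> = pexp (P a) (\<lambda>x. pexp (letter_images P w') (\<lambda>vs.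
      \<Sum>u\<in>legal_words P l. real (count_list (induced_word l (x # vs)) u) * F u))"
    by (simp add: w' pexp_bind P random_substitutionD[OF P])
  also have "\<dots> = pexp (P a) (\<lambda>x. pexp (letter_images P w') (\<lambda>vs. \<Sum>u\<leftarrow>induced_word l (x # vs). F u))"
  proof (intro pexp_cong sum_list_eq_sum_count[symmetric])
    fix x vs assume "x \<in> set_pmf (P a)" "vs \<in> set_pmf (letter_images P w')"
    then show "set (induced_word l (x # vs)) \<subseteq> legal_words P l"
      using window_legal[OF P w l] by (auto simp: ind w' rs_kernel_def)
  qed simp
  also have "\<dots> = pexp (P a) (\<lambda>x. pexp (letter_images P w') (\<lambda>vs. window_sum l F x (concat vs)))"
    by (simp add: ind window_sum_def comp_def interv_sum_list_conv_sum_set_nat atLeast0LessThan)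
  finally show ?thesis by (simp add: transfer_def w' rs_kernel_def)
qed

section \<open>Cylinders\<close>

lemma map_upto_eq_iff: "map x [k..m] = map y [k..m] \<longleftrightarrow> (\<forall>i. k \<le> i \<and> i \<le> m \<longrightarrow> x i = y i)"
  by auto

lemma map_left_shift: "map (left_shift x) [k..m] = map x [k + 1..m + 1]"
  by (rule nth_equalityI) (auto simp: left_shift_def algebra_simps)

lemma cylinder_empty:
  assumes "k \<le> m" "v \<notin> legal_words P (nat (m - k + 1))"
  shows "cylinder P k m v = {}"
  using assms by (auto simp: cylinder_def subshift_def legal_words_def)

lemma left_shift_subshift:
  assumes "x \<in> subshift P"
  shows "left_shift x \<in> subshift P"
  using assms by (auto simp: subshift_def map_left_shift)

lemma vimage_left_shift_cylinder:
  "left_shift -` cylinder P k m v \<inter> subshift P = cylinder P (k + 1) (m + 1) v"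
  by (auto simp: cylinder_def map_left_shift left_shift_subshift)

lemma subshift_borel_sets:
  "sets (subshift_borel P) = sigma_sets (subshift P)
     {U. openin (subtopology (product_topology (\<lambda>i::int. discrete_topology UNIV) UNIV) (subshift P)) U}"
  unfolding subshift_borel_def by (rule sets_measure_of) (auto simp: openin_subtopology)

lemma openin_cylinder:
  "openin (subtopology (product_topology (\<lambda>i::int. discrete_topology UNIV) UNIV) (subshift P)) (cylinder P k m v)"
proof (cases "\<exists>y. v = map y [k..m]")
  case True
  then obtain y where y: "v = map y [k..m]" by blast
  let ?X = "\<lambda>i. if i \<in> {k..m} then {y i} else UNIV"
  have "openin (product_topology (\<lambda>i::int. discrete_topology UNIV) UNIV) (PiE UNIV ?X)"
  proof (rule product_topology_basis)
    show "finite {i. ?X i \<noteq> topspace (discrete_topology UNIV)}"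
      by (rule finite_subset[of _ "{k..m}"]) auto
  qed simp
  moreover have "cylinder P k m v = PiE UNIV ?X \<inter> subshift P"
    unfolding cylinder_def y map_upto_eq_iff by (auto simp: PiE_iff split: if_splits)
  ultimately show ?thesis by (auto simp: openin_subtopology)
next
  case False
  then have "cylinder P k m v = {}" by (auto simp: cylinder_def)
  then show ?thesis by simp
qed

lemma cylinder_measurable: "cylinder P k m v \<in> sets (subshift_borel P)"
  unfolding subshift_borel_sets by (intro sigma_sets.Basic) (simp add: openin_cylinder)

text \<open>Windows centred at 0 are nested, which gives a generator stable under intersection. The
  radius is at least 1 so that the window still contains 0 after one shift, where the defining
  formula of the frequency measure applies.\<close>

definition central_cylinders :: "('a \<Rightarrow> 'a list pmf) \<Rightarrow> (int \<Rightarrow> 'a) set set" where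
  "central_cylinders P = (\<lambda>(n, v). cylinder P (- int (Suc n)) (int (Suc n)) v) ` UNIV"

lemma central_cylinders_Pow: "central_cylinders P \<subseteq> Pow (subshift P)"
  by (auto simp: central_cylinders_def cylinder_def)

lemma countable_central_cylinders: "countable (central_cylinders P)" for P :: "'a::finite \<Rightarrow> 'a list pmf"
  by (simp add: central_cylinders_def)

lemma Union_central_cylinders: "\<Union>(central_cylinders P) = subshift P"
proof -
  have "x \<in> cylinder P (- int (Suc 0)) (int (Suc 0)) (map x [- int (Suc 0)..int (Suc 0)])"
    if "x \<in> subshift P" for x using that by (simp add: cylinder_def)
  then show ?thesis using central_cylinders_Pow[of P] unfolding central_cylinders_def by fast
qed

lemma Int_stable_central_cylinders: "Int_stable (central_cylinders P)"
proof (rule Int_stableI)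
  fix a b assume "a \<in> central_cylinders P" "b \<in> central_cylinders P"
  then obtain n v n' v' where ab: "a = cylinder P (- int (Suc n)) (int (Suc n)) v"
    "b = cylinder P (- int (Suc n')) (int (Suc n')) v'" by (auto simp: central_cylinders_def)
  have nested: "cylinder P (- int (Suc n)) (int (Suc n)) v \<subseteq> cylinder P (- int (Suc n')) (int (Suc n')) v'"
    if "n' \<le> n" "x \<in> cylinder P (- int (Suc n)) (int (Suc n)) v" "x \<in> cylinder P (- int (Suc n')) (int (Suc n')) v'"
    for n n' v v' x
    using that unfolding cylinder_def by (auto simp: map_upto_eq_iff)
  \<comment> \<open>The empty word has the wrong length for a window of three letters.\<close>
  have "{} = cylinder P (- int (Suc 0)) (int (Suc 0)) []" by (auto simp: cylinder_def)
  then have empty: "{} \<in> central_cylinders P" unfolding central_cylinders_def by (intro image_eqI[of _ _ "(0, [])"]) auto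
  show "a \<inter> b \<in> central_cylinders P"
  proof (cases "a \<inter> b = {}")
    case True
    then show ?thesis using empty by simp
  next
    case False
    then obtain x where x: "x \<in> a" "x \<in> b" by blast
    have "a \<subseteq> b \<or> b \<subseteq> a"
      using nested[of n' n x v v'] nested[of n n' x v' v] x unfolding ab by (meson nle_le)
    then show ?thesis using \<open>a \<in> central_cylinders P\<close> \<open>b \<in> central_cylinders P\<close>
      by (metis inf.absorb1 inf.absorb2)
  qed
qed

text \<open>A basic product neighbourhood constrains finitely many coordinates and so contains a
  central cylinder around each of its points in the subshift. As there are countably many central
  cylinders, open sets are countable unions of them.\<close>

lemma subshift_borel_eq_sigma_cylinders:
  fixes P :: "'a::finite \<Rightarrow> 'a list pmf"
  shows "sets (subshift_borel P) = sigma_sets (subshift P) (central_cylinders P)"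
proof (rule antisym)
  let ?T = "product_topology (\<lambda>i::int. discrete_topology (UNIV :: 'a set)) UNIV"
  show "sigma_sets (subshift P) (central_cylinders P) \<subseteq> sets (subshift_borel P)"
    unfolding subshift_borel_sets
    by (rule sigma_sets_mono') (auto simp: central_cylinders_def openin_cylinder)
  show "sets (subshift_borel P) \<subseteq> sigma_sets (subshift P) (central_cylinders P)"
    unfolding subshift_borel_sets
  proof (rule sigma_sets_mono, safe)
    fix U assume "openin (subtopology ?T (subshift P)) U"
    then obtain V where V: "openin ?T V" "U = V \<inter> subshift P" by (auto simp: openin_subtopology)
    have "\<exists>c\<in>central_cylinders P. x \<in> c \<and> c \<subseteq> U" if "x \<in> U" for x
    proof -
      have "x \<in> V" "x \<in> subshift P" using that V by auto
      then obtain X where X: "x \<in> PiE UNIV X" "finite {i. X i \<noteq> topspace (discrete_topology (UNIV :: 'a set))}" "PiE UNIV X \<subseteq> V"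
        using product_topology_open_contains_basis[OF V(1), of x] by auto
      obtain n where n: "\<And>i. X i \<noteq> UNIV \<Longrightarrow> \<bar>i\<bar> \<le> int n"
      proof
        fix i assume "X i \<noteq> UNIV"
        then have "\<bar>i\<bar> \<le> Max (insert 0 (abs ` {i. X i \<noteq> UNIV}))"
          using X(2) by (intro Max_ge) auto
        also have "\<dots> \<le> int (nat (Max (insert 0 (abs ` {i. X i \<noteq> UNIV}))))" by simp
        finally show "\<bar>i\<bar> \<le> int (nat (Max (insert 0 (abs ` {i. X i \<noteq> UNIV}))))" .
      qed
      let ?k = "- int (Suc n)" and ?m = "int (Suc n)"
      have "cylinder P ?k ?m (map x [?k..?m]) \<subseteq> U"
      proof
        fix y assume "y \<in> cylinder P ?k ?m (map x [?k..?m])"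
        then have y: "y \<in> subshift P" "\<And>i. ?k \<le> i \<Longrightarrow> i \<le> ?m \<Longrightarrow> y i = x i"
          unfolding cylinder_def map_upto_eq_iff by auto
        have "y i \<in> X i" for i
        proof (cases "X i = UNIV")
          case False
          then have "y i = x i" using n[of i] y(2)[of i] by auto
          then show ?thesis using X(1) by (auto simp: PiE_iff)
        qed simp
        then have "y \<in> V" using X(3) by (auto simp: PiE_iff)
        then show "y \<in> U" using V y by simp
      qed
      moreover have "x \<in> cylinder P ?k ?m (map x [?k..?m])" using \<open>x \<in> subshift P\<close> by (simp add: cylinder_def)
      ultimately show ?thesis unfolding central_cylinders_def by (intro bexI[of _ "cylinder P ?k ?m (map x [?k..?m])"]) auto
    qed
    then have "U = \<Union>{c\<in>central_cylinders P. c \<subseteq> U}" by blast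
    moreover have "countable {c\<in>central_cylinders P. c \<subseteq> U}"
      using countable_central_cylinders[of P] by (rule countable_subset[rotated]) auto
    ultimately show "U \<in> sigma_sets (subshift P) (central_cylinders P)"
      using sigma_sets_UNION[of "{c\<in>central_cylinders P. c \<subseteq> U}" "subshift P" "central_cylinders P"]
      by (auto intro: sigma_sets.Basic)
  qed
qed

section \<open>Frequency measures\<close>

lemma window_sum_hd:
  assumes "N \<ge> 1"
  shows "window_sum N (\<lambda>u. f (hd u)) x y = (\<Sum>b\<leftarrow>x. f b)"
proof -
  have "window_sum N (\<lambda>u. f (hd u)) x y = (\<Sum>k<length x. f (x ! k))"
    unfolding window_sum_def using assms
    by (intro sum.cong refl arg_cong[of _ _ f]) (auto simp: hd_drop_conv_nth nth_append)
  then show ?thesis by (simp add: sum_list_sum_nth atLeast0LessThan)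
qed

text \<open>On functions of the first letter the induced operator reduces to the substitution on
  letters.\<close>

lemma transfer_hd:
  assumes "random_substitution Q" "N \<ge> 1"
  shows "transfer Q N (\<lambda>u. f (hd u)) w = pexp (Q (hd w)) (\<lambda>x. \<Sum>b\<leftarrow>x. f b)"
  by (simp add: transfer_def window_sum_hd[OF assms(2), abs_def])

text \<open>Only an inequality, since \<open>transfer\<close> also counts occurrences that run over
  from the image of the first letter into the next images.\<close>

lemma transfer_indicator_ge:
  assumes "random_substitution Q"
  shows "transfer Q (length v) (\<lambda>u. of_bool (u = v)) w \<ge> pexp (Q (hd w)) (\<lambda>x. real (occ v x))"
proof -
  have "real (occ v x) \<le> window_sum (length v) (\<lambda>u. of_bool (u = v)) x y" for x y
  proof -
    have "real (occ v x) = (\<Sum>k<length x. of_bool (take (length v) (drop k x) = v))"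
      by (simp add: occ_def of_bool_def sum.If_cases Int_def)
    also have "\<dots> \<le> window_sum (length v) (\<lambda>u. of_bool (u = v)) x y"
      unfolding window_sum_def
    proof (rule sum_mono)
      fix k assume k: "k \<in> {..<length x}"
      show "(of_bool (take (length v) (drop k x) = v) :: real) \<le> of_bool (take (length v) (drop k (x @ y)) = v)"
      proof (cases "take (length v) (drop k x) = v")
        case True
        have "length (take (length v) (drop k x)) = length v" by (simp only: True)
        then have "k + length v \<le> length x" using k by auto
        then show ?thesis using True by simp
      qed simp
    qed
    finally show ?thesis .
  qed
  then have "pexp (rs_kernel Q (tl w)) (\<lambda>y. real (occ v x)) \<le>
      pexp (rs_kernel Q (tl w)) (window_sum (length v) (\<lambda>u. of_bool (u = v)) x)" for x
    by (intro pexp_mono) (auto simp: assms)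
  then show ?thesis
    unfolding transfer_def by (intro pexp_mono) (auto simp: random_substitutionD[OF assms])
qed

lemma pexp_rs_iter_additive:
  assumes "random_substitution P"
  shows "pexp (rs_iter P n w) (\<lambda>y. \<Sum>b\<leftarrow>y. g b) = (\<Sum>a\<leftarrow>w. pexp (rs_iter P n [a]) (\<lambda>y. \<Sum>b\<leftarrow>y. g b))"
  by (subst rs_iter_eq_kernel) (rule pexp_rs_kernel_additive[OF random_substitution_rs_pow[OF assms]])

section \<open>A frequency measure together with its family of eigenvectors\<close>

locale frequency_system =
  fixes P :: "'a::finite \<Rightarrow> 'a list pmf" and \<mu> :: "(int \<Rightarrow> 'a) measure"
    and R :: "nat \<Rightarrow> 'a list \<Rightarrow> real"
  assumes P: "random_substitution P"
    and prim: "rs_primitive P"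
    and expanding: "rs_expanding P"
    and prob: "prob_space \<mu>"
    and sets_\<mu>: "sets \<mu> = sets (subshift_borel P)"
    and pf: "\<And>l. l \<ge> 1 \<Longrightarrow> right_pf_eigenvector (legal_words P l) (induced_matrix P l) (R l)"
    and cyl: "\<And>k m v. k \<le> 0 \<Longrightarrow> 0 \<le> m \<Longrightarrow> v \<in> legal_words P (nat (m - k + 1)) \<Longrightarrow>
           measure \<mu> (cylinder P k m v) = R (nat (m - k + 1)) v"
begin

sublocale prob_space \<mu> by (rule prob)

lemma space_\<mu>: "space \<mu> = subshift P"
  using sets_eq_imp_space_eq[OF sets_\<mu>]
  by (simp add: subshift_borel_def space_measure_of_conv)

lemma cylinder_sets [measurable, simp]: "cylinder P k m v \<in> sets \<mu>"
  by (simp add: sets_\<mu> cylinder_measurable)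

lemma sets_\<mu>_eq: "sets \<mu> = sigma_sets (subshift P) (central_cylinders P)"
  by (simp add: sets_\<mu> subshift_borel_eq_sigma_cylinders)

lemma left_shift_measurable: "left_shift \<in> \<mu> \<rightarrow>\<^sub>M \<mu>"
  by (rule measurable_sigma_sets[OF sets_\<mu>_eq central_cylinders_Pow])
    (auto simp: space_\<mu> left_shift_subshift central_cylinders_def vimage_left_shift_cylinder)

lemma prefix_legal:
  assumes "x \<in> subshift P" "l \<ge> 1"
  shows "map x [0..int l - 1] \<in> legal_words P l"
  using assms by (auto simp: subshift_def legal_words_def)

text \<open>Splits an event by the word read from coordinate 0. The set \<open>A\<close> is the
  whole space in \<open>marginal\<close> and an invariant set in
  \<open>measure_Int_prefix_le\<close>.\<close>

lemma measure_prefix: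
  assumes A: "A \<in> sets \<mu>" and l: "l \<ge> 1"
  shows "measure \<mu> {x\<in>A. \<Phi> (map x [0..int l - 1])} =
    (\<Sum>u\<in>legal_words P l. of_bool (\<Phi> u) * measure \<mu> (A \<inter> cylinder P 0 (int l - 1) u))"
proof -
  have "A \<subseteq> subshift P" using sets.sets_into_space[OF A] by (simp add: space_\<mu>)
  then have "{x\<in>A. \<Phi> (map x [0..int l - 1])} =
      (\<Union>u\<in>{u\<in>legal_words P l. \<Phi> u}. A \<inter> cylinder P 0 (int l - 1) u)"
    using prefix_legal[OF _ l] by (auto simp: cylinder_def)
  moreover have "measure \<mu> (\<Union>u\<in>{u\<in>legal_words P l. \<Phi> u}. A \<inter> cylinder P 0 (int l - 1) u)
      = (\<Sum>u\<in>{u\<in>legal_words P l. \<Phi> u}. measure \<mu> (A \<inter> cylinder P 0 (int l - 1) u))"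
    using A by (intro finite_measure_finite_Union)
      (use A in auto, auto simp: disjoint_family_on_def cylinder_def)
  moreover have "\<dots> = (\<Sum>u\<in>legal_words P l. of_bool (\<Phi> u) * measure \<mu> (A \<inter> cylinder P 0 (int l - 1) u))"
    by (simp add: sum.inter_filter if_distrib[of "\<lambda>c. c * _"] of_bool_def cong: if_cong)
  ultimately show ?thesis by simp
qed

lemma measure_cylinder_prefix:
  assumes "l \<ge> 1" "u \<in> legal_words P l"
  shows "measure \<mu> (cylinder P 0 (int l - 1) u) = R l u"
  using cyl[of 0 "int l - 1" u] assms by simp

lemma R_pos: "l \<ge> 1 \<Longrightarrow> u \<in> legal_words P l \<Longrightarrow> R l u > 0"
  using pf[of l] by (auto simp: right_pf_eigenvector_def)

lemma R_sum: "l \<ge> 1 \<Longrightarrow> (\<Sum>u\<in>legal_words P l. R l u) = 1"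
proof -
  assume l: "l \<ge> 1"
  have "(\<Sum>u\<in>legal_words P l. R l u) = (\<Sum>u\<in>legal_words P l. \<bar>R l u\<bar>)"
    using R_pos[OF l] by (intro sum.cong) (auto simp: abs_of_pos)
  then show ?thesis using pf[OF l] by (simp add: right_pf_eigenvector_def)
qed

section \<open>Letter frequencies, the inflation factor and stationarity under inflation\<close>

definition letter_freq :: "'a \<Rightarrow> real" where
  "letter_freq b = R 1 [b]"

lemma singleton_legal: "[b] \<in> legal_words P 1"
  by (simp add: legal_words_def singleton_in_language)

lemma letter_freq_pos: "letter_freq b > 0"
  unfolding letter_freq_def by (rule R_pos[OF _ singleton_legal]) simp

text \<open>The vectors \<open>R l\<close> are cylinder weights of one measure, so their
  first-letter marginals agree. This links the eigenvectors of different lengths.\<close>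

lemma marginal:
  assumes l: "l \<ge> 1"
  shows "(\<Sum>w\<in>legal_words P l. R l w * f (hd w)) = (\<Sum>b\<in>UNIV. letter_freq b * f b)"
proof -
  have "letter_freq b = (\<Sum>w\<in>legal_words P l. of_bool (hd w = b) * R l w)" for b
  proof -
    have "letter_freq b = measure \<mu> (cylinder P 0 0 [b])"
      using measure_cylinder_prefix[of 1 "[b]"] singleton_legal by (simp add: letter_freq_def)
    also have "cylinder P 0 0 [b] = {x\<in>space \<mu>. hd (map x [0..int l - 1]) = b}"
      using l by (auto simp: cylinder_def space_\<mu> hd_map upto_rec1)
    also have "measure \<mu> \<dots> = (\<Sum>w\<in>legal_words P l. of_bool (hd w = b) * measure \<mu> (space \<mu> \<inter> cylinder P 0 (int l - 1) w))"
      by (rule measure_prefix[OF _ l]) simp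
    also have "\<dots> = (\<Sum>w\<in>legal_words P l. of_bool (hd w = b) * R l w)"
    proof (rule sum.cong)
      fix w assume w: "w \<in> legal_words P l"
      have "space \<mu> \<inter> cylinder P 0 (int l - 1) w = cylinder P 0 (int l - 1) w"
        by (auto simp: space_\<mu> cylinder_def)
      then show "of_bool (hd w = b) * measure \<mu> (space \<mu> \<inter> cylinder P 0 (int l - 1) w) = of_bool (hd w = b) * R l w"
        using measure_cylinder_prefix[OF l w] by simp
    qed simp
    finally show ?thesis .
  qed
  then have "(\<Sum>b\<in>UNIV. letter_freq b * f b) = (\<Sum>b\<in>UNIV. \<Sum>w\<in>legal_words P l. of_bool (hd w = b) * R l w * f b)"
    by (simp only: sum_distrib_right)
  also have "\<dots> = (\<Sum>w\<in>legal_words P l. \<Sum>b\<in>UNIV. of_bool (hd w = b) * R l w * f b)"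
    by (rule sum.swap)
  also have "\<dots> = (\<Sum>w\<in>legal_words P l. R l w * f (hd w))"
    by (simp add: of_bool_def if_distrib[of "\<lambda>c. c * _"] cong: if_cong)
  finally show ?thesis by simp
qed

lemma letter_freq_sum: "(\<Sum>b\<in>UNIV. letter_freq b) = 1"
  using marginal[of 1 "\<lambda>_. 1"] R_sum[of 1] by simp

text \<open>The mean image length of a letter drawn by frequency. \<open>transfer_eigen\<close>
  shows that it is the eigenvalue belonging to every \<open>R l\<close>.\<close>

definition inflation :: real where
  "inflation = (\<Sum>b\<in>UNIV. letter_freq b * pexp (P b) (\<lambda>x. real (length x)))"

lemma transfer_eigen:
  assumes l: "l \<ge> 1"
  shows "inflation * (\<Sum>u\<in>legal_words P l. R l u * F u) = (\<Sum>w\<in>legal_words P l. R l w * transfer P l F w)"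
proof -
  obtain c where c: "\<And>u. u \<in> legal_words P l \<Longrightarrow>
      (\<Sum>w\<in>legal_words P l. induced_matrix P l u w * R l w) = c * R l u"
    using pf[OF l] by (auto simp: right_pf_eigenvector_def)
  have eig: "c * (\<Sum>u\<in>legal_words P l. R l u * F u) = (\<Sum>w\<in>legal_words P l. R l w * transfer P l F w)" for F
  proof -
    have "c * (\<Sum>u\<in>legal_words P l. R l u * F u)
       = (\<Sum>u\<in>legal_words P l. (\<Sum>w\<in>legal_words P l. induced_matrix P l u w * R l w) * F u)"
      unfolding sum_distrib_left by (intro sum.cong refl) (simp only: c mult.assoc)
    also have "\<dots> = (\<Sum>w\<in>legal_words P l. R l w * (\<Sum>u\<in>legal_words P l. F u * induced_matrix P l u w))"
      unfolding sum_distrib_left sum_distrib_right by (subst sum.swap) (simp add: mult_ac)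
    also have "\<dots> = (\<Sum>w\<in>legal_words P l. R l w * transfer P l F w)"
      by (simp add: sum_induced_matrix[OF P _ l])
    finally show ?thesis .
  qed
  \<comment> \<open>Tested on the constant 1, \<open>transfer\<close> yields the mean length of the
    image of the first letter.\<close>
  have "c = inflation"
    using eig[of "\<lambda>_. 1"] R_sum[OF l] transfer_hd[OF P l, of "\<lambda>_. 1"] marginal[OF l]
    by (simp add: inflation_def sum_list_triv)
  then show ?thesis using eig by simp
qed

text \<open>Stationarity under inflation: averaging over windows that start in the image of the
  first letter of an \<open>R l\<close>-distributed word reproduces \<open>R l\<close>, up to the
  factor \<open>inflation ^ n\<close>.\<close>

lemma transfer_pow_eigen:
  assumes l: "l \<ge> 1"
  shows "inflation ^ n * (\<Sum>u\<in>legal_words P l. R l u * F u) =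
    (\<Sum>w\<in>legal_words P l. R l w * transfer (rs_pow P n) l F w)"
proof (induction n arbitrary: F)
  case 0
  have "transfer (rs_pow P 0) l F w = F w" if "w \<in> legal_words P l" for w
    using that l by (cases w) (auto simp: transfer_def rs_kernel_return window_sum_def legal_words_def)
  then show ?case by simp
next
  case (Suc n)
  have "transfer (rs_pow P (Suc n)) l F w = transfer (rs_pow P n) l (transfer P l F) w"
    if "w \<in> legal_words P l" for w
    using transfer_bind[OF P random_substitution_rs_pow[OF P] l, of w] that by (simp add: legal_words_def)
  then have "(\<Sum>w\<in>legal_words P l. R l w * transfer (rs_pow P (Suc n)) l F w)
     = inflation ^ n * (\<Sum>u\<in>legal_words P l. R l u * transfer P l F u)"
    by (simp add: Suc)
  then show ?case by (simp add: transfer_eigen[OF l, symmetric])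
qed

lemma inflation_gt_1: "inflation > 1"
proof -
  have ge: "pexp (P b) (\<lambda>x. real (length x)) \<ge> 1" for b
  proof -
    have "pexp (P b) (\<lambda>x. 1) \<le> pexp (P b) (\<lambda>x. real (length x))"
      using random_substitutionD[OF P] by (intro pexp_mono) (auto simp: Suc_le_eq)
    then show ?thesis by simp
  qed
  obtain a where a: "measure_pmf.prob (P a) {w. length w > 1} > 0"
    using expanding by (auto simp: rs_expanding_def)
  have "pexp (P a) (\<lambda>x. 1 + indicator {w. length w > 1} x) \<le> pexp (P a) (\<lambda>x. real (length x))"
    using random_substitutionD[OF P] by (intro pexp_mono) (auto simp: Suc_le_eq indicator_def)
  then have gt: "pexp (P a) (\<lambda>x. real (length x)) > 1"
    using a by (simp add: pexp_const_add random_substitutionD[OF P])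
  have "(\<Sum>b\<in>UNIV. letter_freq b) < inflation"
    unfolding inflation_def
  proof (rule sum_strict_mono_ex1)
    show "\<forall>b\<in>UNIV. letter_freq b \<le> letter_freq b * pexp (P b) (\<lambda>x. real (length x))"
      using mult_left_mono[OF ge less_imp_le[OF letter_freq_pos]] by simp
    show "\<exists>b\<in>UNIV. letter_freq b < letter_freq b * pexp (P b) (\<lambda>x. real (length x))"
      using gt letter_freq_pos[of a] by (intro bexI[of _ a]) (auto simp: mult_less_cancel_left1)
  qed simp
  then show ?thesis by (simp add: letter_freq_sum)
qed

lemma mean_matrix_eigen: "(\<Sum>b\<in>UNIV. mean_matrix P a b * letter_freq b) = inflation * letter_freq a"
proof -
  have "inflation * (\<Sum>b\<in>UNIV. letter_freq b * of_bool (b = a))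
     = inflation * (\<Sum>u\<in>legal_words P 1. R 1 u * of_bool (hd u = a))"
    by (subst marginal) simp_all
  also have "\<dots> = (\<Sum>w\<in>legal_words P 1. R 1 w * pexp (P (hd w)) (\<lambda>x. \<Sum>b\<leftarrow>x. of_bool (b = a)))"
    by (subst transfer_eigen) (simp_all only: transfer_hd[OF P order_refl, of "\<lambda>b. of_bool (b = a)"] order_refl)
  also have "\<dots> = (\<Sum>b\<in>UNIV. letter_freq b * (\<Sum>c\<in>UNIV. mean_matrix P c b * of_bool (c = a)))"
    by (subst marginal[OF order_refl, of "\<lambda>b. pexp (P b) (\<lambda>x. \<Sum>b\<leftarrow>x. of_bool (b = a))"])
      (simp only: pexp_additive[OF P])
  finally show ?thesis by (simp add: mult.commute)
qed

text \<open>A first power makes the frequency average of the mean excess negative;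
  \<open>p * m\<close> further steps spread this negativity to every single letter.\<close>

lemma negative_drift:
  assumes v: "v \<in> legal_words P (length v)" "v \<noteq> []" and g: "g > R (length v) v"
  obtains n where "\<And>a. pexp (rs_iter P n [a]) (excess v g) < 0"
proof -
  let ?l = "length v" and ?\<epsilon> = "g - R (length v) v"
  have l: "?l \<ge> 1" using v(2) by (cases v) auto
  \<comment> \<open>Chosen so that the mean gain \<open>?\<epsilon> * inflation ^ n\<close>
    outweighs the constant \<open>length v\<close> in the excess.\<close>
  obtain n where n: "real ?l / ?\<epsilon> < inflation ^ n"
    using real_arch_pow[OF inflation_gt_1] by blast
  have Q: "random_substitution (rs_pow P n)" by (rule random_substitution_rs_pow[OF P])
  define h where "h b = pexp (rs_iter P n [b]) (excess v g)" for b
  have "(\<Sum>b\<in>UNIV. letter_freq b * h b) < 0"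
  proof -
    have occ_le: "(\<Sum>b\<in>UNIV. letter_freq b * pexp (rs_iter P n [b]) (\<lambda>x. real (occ v x))) \<le> inflation ^ n * R ?l v"
    proof -
      have "(\<Sum>b\<in>UNIV. letter_freq b * pexp (rs_iter P n [b]) (\<lambda>x. real (occ v x)))
         \<le> (\<Sum>w\<in>legal_words P ?l. R ?l w * transfer (rs_pow P n) ?l (\<lambda>u. of_bool (u = v)) w)"
        unfolding marginal[OF l, symmetric]
        using transfer_indicator_ge[OF Q, of _ v] R_pos[OF l] by (intro sum_mono mult_left_mono) (auto simp: less_imp_le)
      also have "\<dots> = inflation ^ n * (\<Sum>u\<in>legal_words P ?l. R ?l u * of_bool (u = v))"
        by (rule transfer_pow_eigen[OF l, symmetric])
      also have "\<dots> = inflation ^ n * R ?l v"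
        using v by (simp add: of_bool_def if_distrib[of "\<lambda>c. _ * c"] cong: if_cong)
      finally show ?thesis .
    qed
    have len: "(\<Sum>b\<in>UNIV. letter_freq b * pexp (rs_iter P n [b]) (\<lambda>x. real (length x))) = inflation ^ n"
      using transfer_pow_eigen[OF l, of n "\<lambda>_. 1"] transfer_hd[OF Q l, of "\<lambda>_. 1"]
        marginal[OF l, of "\<lambda>b. pexp (rs_iter P n [b]) (\<lambda>x. real (length x))"] R_sum[OF l]
      by (simp add: sum_list_triv)
    have "h b = pexp (rs_iter P n [b]) (\<lambda>x. real (occ v x)) + ?l - g * pexp (rs_iter P n [b]) (\<lambda>x. real (length x))" for b
      unfolding h_def excess_def[abs_def] by (simp add: pexp_diff pexp_add_const P)
    then have "(\<Sum>b\<in>UNIV. letter_freq b * h b) =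
        (\<Sum>b\<in>UNIV. letter_freq b * pexp (rs_iter P n [b]) (\<lambda>x. real (occ v x))) + ?l * (\<Sum>b\<in>UNIV. letter_freq b)
        - g * (\<Sum>b\<in>UNIV. letter_freq b * pexp (rs_iter P n [b]) (\<lambda>x. real (length x)))"
      by (simp only: ring_distribs sum.distrib sum_subtractf sum_distrib_left) (simp add: mult_ac)
    also have "\<dots> \<le> inflation ^ n * R ?l v + ?l - g * inflation ^ n"
      using occ_le by (simp add: len letter_freq_sum)
    also have "\<dots> = ?l - ?\<epsilon> * inflation ^ n" by (simp add: algebra_simps)
    also have "\<dots> < 0" using n g by (simp add: field_simps)
    finally show ?thesis .
  qed
  obtain p where p: "\<And>b a. mat_power UNIV (mean_matrix P) p b a > 0"
    using prim by (auto simp: rs_primitive_def primitive_matrix_def)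
  \<comment> \<open>By subadditivity \<open>W m a\<close> bounds the mean excess after
    \<open>p * m + n\<close> steps, and unlike that mean it evolves linearly.\<close>
  define W where "W m a = pexp (rs_iter P (p * m) [a]) (\<lambda>w. \<Sum>b\<leftarrow>w. h b)" for m a
  have "\<exists>m. \<forall>a. W m a < 0"
  proof (rule positive_matrix_negative_drift[where K = "mat_power UNIV (mean_matrix P) p"
        and r = letter_freq and L = "inflation ^ p"])
    show "(\<Sum>a\<in>UNIV. mat_power UNIV (mean_matrix P) p b a * letter_freq a) = inflation ^ p * letter_freq b" for b
      by (rule mat_power_eigenvector) (simp_all add: mean_matrix_eigen)
    show "W (Suc m) a = (\<Sum>b\<in>UNIV. mat_power UNIV (mean_matrix P) p b a * W m b)" for m a
    proof -
      have "W (Suc m) a = pexp (rs_iter P p [a]) (\<lambda>x. pexp (rs_iter P (p * m) x) (\<lambda>w. \<Sum>b\<leftarrow>w. h b))"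
        by (simp add: W_def rs_iter_add pexp_bind P)
      also have "\<dots> = pexp (rs_iter P p [a]) (\<lambda>x. \<Sum>b\<leftarrow>x. W m b)"
        unfolding W_def by (intro pexp_cong pexp_rs_iter_additive[OF P])
      finally show ?thesis by (simp add: pexp_rs_pow_additive[OF P])
    qed
    show "(\<Sum>b\<in>UNIV. letter_freq b * W 0 b) < 0"
      using \<open>(\<Sum>b\<in>UNIV. letter_freq b * h b) < 0\<close> by (simp add: W_def)
  qed (simp_all add: p letter_freq_pos letter_freq_sum)
  then obtain m where m: "\<And>a. W m a < 0" by blast
  have "pexp (rs_iter P (p * m + n) [a]) (excess v g) < 0" for a
  proof -
    have "pexp (rs_iter P (p * m + n) [a]) (excess v g)
       = pexp (rs_iter P (p * m) [a]) (\<lambda>w. pexp (rs_kernel (rs_pow P n) w) (excess v g))"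
      by (simp add: rs_iter_add pexp_bind P rs_iter_eq_kernel[of P n, symmetric])
    also have "\<dots> \<le> W m a" unfolding W_def h_def
      using length_rs_iter[OF P, of _ _ "[a]"]
      by (intro pexp_mono pexp_rs_kernel_subadditive Q excess_append) (fastforce simp: P)+
    finally show ?thesis using m[of a] by simp
  qed
  then show ?thesis by (rule that)
qed

section \<open>Ergodicity\<close>

text \<open>By stationarity a word drawn from \<open>R N\<close> can be replaced by windows of
  inflated words. These are concatenations of independent blocks of length at most \<open>C\<close>,
  so the walk estimate applies with a constant free of \<open>N\<close>.\<close>

lemma uniform_excess_bound:
  assumes v: "v \<in> legal_words P (length v)" "v \<noteq> []" and g: "g > R (length v) v"
  obtains K where
    "\<And>N. N \<ge> 1 \<Longrightarrow> (\<Sum>u\<in>legal_words P N. R N u * max 0 (real (occ v u) - g * real N)) \<le> K"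
proof -
  obtain n where drift: "\<And>a. pexp (rs_iter P n [a]) (excess v g) < 0"
    using negative_drift[OF v g] by blast
  have Q: "random_substitution (rs_pow P n)" by (rule random_substitution_rs_pow[OF P])
  obtain t \<rho> where t: "t > 0" and \<rho>: "0 \<le> \<rho>" "\<rho> < 1"
    and moment: "\<And>a. pexp (rs_iter P n [a]) (\<lambda>x. exp (t * excess v g x)) \<le> \<rho>"
    using uniform_exp_moment[OF Q drift] by blast
  have g0: "g > 0" using g R_pos[of "length v" v] v by (cases v) auto
  have "finite (\<Union>a. set_pmf (rs_iter P n [a]))" by (simp add: P)
  then have "finite (length ` (\<Union>a. set_pmf (rs_iter P n [a])))" by blast
  then obtain C where "\<forall>k \<in> length ` (\<Union>a. set_pmf (rs_iter P n [a])). k \<le> C"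
    by (auto simp only: finite_nat_set_iff_bounded_le)
  then have C: "\<And>a x. x \<in> set_pmf (rs_iter P n [a]) \<Longrightarrow> length x \<le> C" by auto
  \<comment> \<open>Bounds the exponential step of the first block, which \<open>transfer\<close>
    draws separately from the others.\<close>
  define E where "E = exp (t * (real C + real (length v)))"
  \<comment> \<open>One \<open>g * C\<close> covers the incomplete last block, the other the letters
    of the first block before the window; the rest bounds the expected logarithm of
    \<open>walk_sum\<close>.\<close>
  define B where "B = 2 * g * real C + (1 + E * (1 / (1 - \<rho>))) / t"
  have E: "E \<ge> 0" by (simp add: E_def)
  have walk_le: "walk_sum (excess v g) t (x # xs) \<le> 1 + E * walk_sum (excess v g) t xs"
    if "length x \<le> C" for x xs
  proof -
    have "occ v x \<le> card {..<length x}" unfolding occ_def by (intro card_mono) auto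
    then have "real (occ v x) \<le> real C" using that by simp
    moreover have "0 \<le> g * real (length x)" using g0 by simp
    ultimately have "excess v g x \<le> real C + real (length v)" by (simp add: excess_def)
    then show ?thesis
      using t walk_sum_ge_1[of "excess v g" t xs] by (simp add: E_def mult_right_mono)
  qed
  let ?F = "\<lambda>N u. max 0 (real (occ v u) - g * real N)"
  have window: "window_sum N (?F N) x (concat xs) \<le> real C * (2 * g * real C + (1 + E * walk_sum (excess v g) t xs) / t)"
    if x: "length x \<le> C" and xs: "\<And>y. y \<in> set xs \<Longrightarrow> length y \<le> C" for N x xs
  proof -
    have nonneg: "0 \<le> 2 * g * real C + (1 + E * walk_sum (excess v g) t xs) / t"
      using g0 t E walk_sum_ge_1[of "excess v g" t xs] by simp
    have "?F N (take N (drop k (x @ concat xs))) \<le> 2 * g * real C + (1 + E * walk_sum (excess v g) t xs) / t"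
      if k: "k < length x" for k
    proof -
      let ?W = "walk_sum (excess v g) t (x # xs)"
      \<comment> \<open>Enlarging the window to a prefix makes it start at a block boundary, as the
        walk estimate requires.\<close>
      have "occ v (take N (drop k (x @ concat xs))) \<le> occ v (take (k + N) (concat (x # xs)))"
        using occ_take_drop[of v N k "concat (x # xs)"] by simp
      moreover have "t * (real (occ v (take (k + N) (concat (x # xs)))) - g * real (k + N) - g * real C) \<le> ln ?W"
        using x xs t g0 by (intro occ_take_concat_le) auto
      \<comment> \<open>A crude bound suffices: \<open>walk_sum\<close> itself has bounded
        expectation.\<close>
      moreover have "ln ?W \<le> ?W"
        using ln_le_minus_one[of ?W] walk_sum_ge_1[of "excess v g" t "x # xs"] by linarith
      ultimately have "real (occ v (take N (drop k (x @ concat xs)))) - g * real (k + N) - g * real C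
          \<le> (1 + E * walk_sum (excess v g) t xs) / t"
        using walk_le[OF x, of xs] t by (simp add: le_divide_eq mult.commute) (smt (verit) mult_left_mono of_nat_mono)
      moreover have "g * real k \<le> g * real C" using k x g0 by (intro mult_left_mono) auto
      ultimately have "real (occ v (take N (drop k (x @ concat xs)))) - g * real N
          \<le> 2 * g * real C + (1 + E * walk_sum (excess v g) t xs) / t" by (simp add: algebra_simps)
      then show ?thesis using nonneg by simp
    qed
    then have "window_sum N (?F N) x (concat xs)
        \<le> real (card {..<length x}) * (2 * g * real C + (1 + E * walk_sum (excess v g) t xs) / t)"
      unfolding window_sum_def by (intro sum_bounded_above) auto
    also have "\<dots> \<le> real C * (2 * g * real C + (1 + E * walk_sum (excess v g) t xs) / t)"
      using x nonneg by (intro mult_right_mono) auto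
    finally show ?thesis .
  qed
  have images: "length y \<le> C" if "xs \<in> set_pmf (letter_images (rs_pow P n) w)" "y \<in> set xs" for xs w y
    using that by (induction w arbitrary: xs) (auto dest: C)
  have transfer_le: "transfer (rs_pow P n) N (?F N) w \<le> real C * B" for N w
  proof -
    have "pexp (rs_kernel (rs_pow P n) (tl w)) (window_sum N (?F N) x) \<le> real C * B" if x: "length x \<le> C" for x
    proof -
      let ?L = "letter_images (rs_pow P n) (tl w)"
      have "pexp (rs_kernel (rs_pow P n) (tl w)) (window_sum N (?F N) x)
          \<le> pexp ?L (\<lambda>xs. real C * (2 * g * real C + (1 + E * walk_sum (excess v g) t xs) / t))"
        unfolding rs_kernel_def integral_map_pmf
        using images by (intro pexp_mono window x) (auto simp: Q)
      also have "\<dots> = real C * (2 * g * real C + (1 + E * pexp ?L (walk_sum (excess v g) t)) / t)"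
        by (simp add: pexp_const_add Q)
      also have "\<dots> \<le> real C * B"
        unfolding B_def using t E pexp_walk_sum_le[OF Q \<rho> moment, of "tl w"]
        by (intro mult_left_mono add_left_mono divide_right_mono) auto
      finally show ?thesis .
    qed
    then have "transfer (rs_pow P n) N (?F N) w \<le> pexp (rs_pow P n (hd w)) (\<lambda>_. real C * B)"
      unfolding transfer_def using C by (intro pexp_mono) (auto simp: P)
    then show ?thesis by simp
  qed
  have "(\<Sum>u\<in>legal_words P N. R N u * ?F N u) \<le> real C * B / inflation ^ n" if N: "N \<ge> 1" for N
  proof -
    have "inflation ^ n * (\<Sum>u\<in>legal_words P N. R N u * ?F N u)
        \<le> (\<Sum>w\<in>legal_words P N. R N w * (real C * B))"
      unfolding transfer_pow_eigen[OF N]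
      using R_pos[OF N] by (intro sum_mono mult_left_mono transfer_le) (auto simp: less_imp_le)
    also have "\<dots> = real C * B" by (simp only: sum_distrib_right[symmetric] R_sum[OF N] mult_1)
    finally show ?thesis using inflation_gt_1 by (simp add: le_divide_eq mult.commute)
  qed
  then show ?thesis by (rule that)
qed

section \<open>Shift invariance and independence of invariant sets from cylinders\<close>

lemma distr_left_shift: "distr \<mu> \<mu> left_shift = \<mu>"
proof (rule measure_eqI_generator_eq_countable[symmetric,
      where E = "central_cylinders P" and \<Omega> = "subshift P" and A = "central_cylinders P"])
  fix X assume "X \<in> central_cylinders P"
  then obtain n v where X: "X = cylinder P (- int (Suc n)) (int (Suc n)) v" by (auto simp: central_cylinders_def)
  have "emeasure (distr \<mu> \<mu> left_shift) X = emeasure \<mu> (cylinder P (- int (Suc n) + 1) (int (Suc n) + 1) v)"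
    by (simp add: emeasure_distr left_shift_measurable X space_\<mu> vimage_left_shift_cylinder)
  also have "\<dots> = emeasure \<mu> X"
  proof (cases "v \<in> legal_words P (nat (int (Suc n) - (- int (Suc n)) + 1))")
    case True
    \<comment> \<open>Both windows contain 0 and have equal length, so the defining formula assigns
      them the same value.\<close>
    then show ?thesis
      using cyl[of "- int (Suc n)" "int (Suc n)" v] cyl[of "- int (Suc n) + 1" "int (Suc n) + 1" v]
      by (simp add: X emeasure_eq_measure)
  next
    case False
    then show ?thesis unfolding X by (simp add: cylinder_empty)
  qed
  finally show "emeasure \<mu> X = emeasure (distr \<mu> \<mu> left_shift) X" by simp
qed (simp_all add: Int_stable_central_cylinders central_cylinders_Pow sets_\<mu>_eq
    Union_central_cylinders countable_central_cylinders)

lemma measure_invariant_Int_cylinder: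
  assumes A: "A \<in> sets \<mu>" and inv: "left_shift -` A \<inter> space \<mu> = A"
  shows "measure \<mu> (A \<inter> cylinder P (k + int j) (m + int j) v) = measure \<mu> (A \<inter> cylinder P k m v)"
proof (induction j)
  case (Suc j)
  let ?c = "cylinder P (k + int j) (m + int j) v"
  have "measure \<mu> (A \<inter> ?c) = measure (distr \<mu> \<mu> left_shift) (A \<inter> ?c)" by (simp only: distr_left_shift)
  also have "\<dots> = measure \<mu> (left_shift -` (A \<inter> ?c) \<inter> space \<mu>)"
    using A by (intro measure_distr left_shift_measurable) auto
  also have "left_shift -` (A \<inter> ?c) \<inter> space \<mu> = A \<inter> (left_shift -` ?c \<inter> subshift P)"
    using inv space_\<mu> by auto
  also have "\<dots> = A \<inter> cylinder P (k + int (Suc j)) (m + int (Suc j)) v"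
    by (simp add: vimage_left_shift_cylinder add_ac)
  finally show ?case using Suc by simp
qed simp

text \<open>For invariant \<open>A\<close> the measure of the intersection is the same at every
  position of the cylinder. Summing over the positions in a long prefix gives an average of
  \<open>occ v\<close> over \<open>A\<close>, at most \<open>g * N\<close> times the measure of
  \<open>A\<close> plus a constant.\<close>

lemma measure_Int_prefix_le:
  assumes A: "A \<in> sets \<mu>" and inv: "left_shift -` A \<inter> space \<mu> = A"
    and v: "v \<in> legal_words P (length v)" "v \<noteq> []"
  shows "measure \<mu> (A \<inter> cylinder P 0 (int (length v) - 1) v) \<le> measure \<mu> A * R (length v) v"
proof (rule field_le_epsilon)
  fix \<epsilon> :: real assume \<epsilon>: "\<epsilon> > 0"
  let ?l = "length v" and ?a = "measure \<mu> (A \<inter> cylinder P 0 (int (length v) - 1) v)"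
  let ?g = "R ?l v + \<epsilon>" and ?b = "measure \<mu> A"
  have l: "?l \<ge> 1" using v(2) by (cases v) auto
  obtain K where K: "\<And>N. N \<ge> 1 \<Longrightarrow> (\<Sum>u\<in>legal_words P N. R N u * max 0 (real (occ v u) - ?g * real N)) \<le> K"
    using uniform_excess_bound[OF v, of ?g] \<epsilon> by auto
  \<comment> \<open>\<open>Suc (N - ?l)\<close> is the number of positions at which \<open>v\<close>
    fits into a word of length \<open>N\<close>.\<close>
  have bound: "real (Suc (N - ?l)) * ?a \<le> ?g * real N * ?b + K" if N: "N \<ge> ?l" for N
  proof -
    have N1: "N \<ge> 1" using N l by simp
    let ?c = "\<lambda>u. measure \<mu> (A \<inter> cylinder P 0 (int N - 1) u)"
    have total: "(\<Sum>u\<in>legal_words P N. ?c u) = ?b"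
      using measure_prefix[OF A N1, of "\<lambda>_. True"] by simp
    have a_eq: "?a = (\<Sum>u\<in>legal_words P N. of_bool (take ?l (drop j u) = v) * ?c u)" if j: "j < Suc (N - ?l)" for j
    proof -
      have sub: "A \<subseteq> subshift P" using sets.sets_into_space[OF A] by (simp add: space_\<mu>)
      have window: "take ?l (drop j (map x [0..int N - 1])) = map x [int j..int ?l - 1 + int j]" for x
        using j N by (intro nth_equalityI) auto
      have "?a = measure \<mu> (A \<inter> cylinder P (int j) (int ?l - 1 + int j) v)"
        using measure_invariant_Int_cylinder[OF A inv, of 0 j "int ?l - 1" v] by simp
      also have "A \<inter> cylinder P (int j) (int ?l - 1 + int j) v
          = {x\<in>A. take ?l (drop j (map x [0..int N - 1])) = v}"
        using sub unfolding window by (auto simp: cylinder_def)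
      also have "measure \<mu> \<dots> = (\<Sum>u\<in>legal_words P N. of_bool (take ?l (drop j u) = v) * ?c u)"
        by (rule measure_prefix[OF A N1])
      finally show ?thesis .
    qed
    have "real (Suc (N - ?l)) * ?a = (\<Sum>j<Suc (N - ?l). ?a)" by simp
    also have "\<dots> = (\<Sum>j<Suc (N - ?l). \<Sum>u\<in>legal_words P N. of_bool (take ?l (drop j u) = v) * ?c u)"
      by (intro sum.cong refl a_eq) simp
    also have "\<dots> = (\<Sum>u\<in>legal_words P N. (\<Sum>j<Suc (N - ?l). of_bool (take ?l (drop j u) = v)) * ?c u)"
      unfolding sum_distrib_right by (rule sum.swap)
    also have "\<dots> \<le> (\<Sum>u\<in>legal_words P N. ?g * real N * ?c u + R N u * max 0 (real (occ v u) - ?g * real N))"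
    proof (rule sum_mono)
      fix u assume u: "u \<in> legal_words P N"
      have "(\<Sum>j<Suc (N - ?l). of_bool (take ?l (drop j u) = v)) \<le> (\<Sum>j<length u. of_bool (take ?l (drop j u) = v) :: real)"
        using u N l by (intro sum_mono2) (auto simp: legal_words_def)
      also have "\<dots> = real (occ v u)"
        by (simp add: occ_def of_bool_def sum.If_cases Int_def)
      also have "\<dots> \<le> ?g * real N + max 0 (real (occ v u) - ?g * real N)" by simp
      finally have "(\<Sum>j<Suc (N - ?l). of_bool (take ?l (drop j u) = v)) * ?c u
          \<le> (?g * real N + max 0 (real (occ v u) - ?g * real N)) * ?c u"
        by (rule mult_right_mono) simp
      \<comment> \<open>Only in the positive excess is \<open>A\<close> enlarged to the whole space;
        the main term keeps the measure of \<open>A\<close>.\<close>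
      also have "?c u \<le> R N u"
        unfolding measure_cylinder_prefix[OF N1 u, symmetric] by (rule finite_measure_mono) auto
      then have "(?g * real N + max 0 (real (occ v u) - ?g * real N)) * ?c u
          \<le> ?g * real N * ?c u + R N u * max 0 (real (occ v u) - ?g * real N)"
        by (simp add: distrib_right mult.commute[of _ "max _ _"] mult_left_mono)
      finally show "(\<Sum>j<Suc (N - ?l). of_bool (take ?l (drop j u) = v)) * ?c u
          \<le> ?g * real N * ?c u + R N u * max 0 (real (occ v u) - ?g * real N)" .
    qed
    also have "\<dots> \<le> ?g * real N * ?b + K"
      using K[OF N1] by (simp add: sum.distrib sum_distrib_left[symmetric] total)
    finally show ?thesis .
  qed
  have "?a \<le> ?g * ?b"
  proof (rule ccontr)
    assume "\<not> ?a \<le> ?g * ?b"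
    then have "?a - ?g * ?b > 0" by simp
    \<comment> \<open>A positive gap would grow linearly in \<open>N\<close>, while the error stays
      below \<open>K\<close> plus the \<open>?l\<close> positions lost at the end.\<close>
    then obtain N where N: "K + real ?l < real N * (?a - ?g * ?b)"
      using reals_Archimedean3 by blast
    let ?N = "max N ?l"
    have "real N * (?a - ?g * ?b) \<le> real ?N * (?a - ?g * ?b)"
      using \<open>?a - ?g * ?b > 0\<close> by (intro mult_right_mono) auto
    moreover have "real ?N * ?a \<le> real (Suc (?N - ?l)) * ?a + real ?l * ?a"
      by (simp add: of_nat_diff algebra_simps)
    moreover have "real ?l * ?a \<le> real ?l" by (simp add: mult_left_le)
    moreover have "real (Suc (?N - ?l)) * ?a \<le> real ?N * (?g * ?b) + K"
      using bound[of ?N] by (simp add: mult_ac)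
    ultimately show False using N unfolding right_diff_distrib by linarith
  qed
  also have "\<dots> \<le> ?b * R ?l v + \<epsilon>"
    using \<epsilon> by (simp add: algebra_simps mult_left_le)
  finally show "?a \<le> ?b * R ?l v + \<epsilon>" .
qed

text \<open>The upper bounds for \<open>A\<close> and for its complement add up to the measure of
  the cylinder, so neither can be strict.\<close>

lemma measure_Int_cylinder:
  assumes A: "A \<in> sets \<mu>" and inv: "left_shift -` A \<inter> space \<mu> = A"
  shows "measure \<mu> (A \<inter> cylinder P (- int n) (int n) v) = measure \<mu> A * measure \<mu> (cylinder P (- int n) (int n) v)"
proof (cases "v \<in> legal_words P (nat (int n - (- int n) + 1))")
  case False
  then show ?thesis by (simp add: cylinder_empty)
next
  case True
  let ?Z = "cylinder P (- int n) (int n) v"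
  have len: "length v = Suc (2 * n)" using True by (auto simp: legal_words_def)
  then have v: "v \<in> legal_words P (length v)" "v \<noteq> []" using True by (auto simp: legal_words_def)
  have le: "measure \<mu> (B \<inter> ?Z) \<le> measure \<mu> B * measure \<mu> ?Z"
    if B: "B \<in> sets \<mu>" "left_shift -` B \<inter> space \<mu> = B" for B
  proof -
    \<comment> \<open>Shifting by \<open>n\<close> moves the centred window to coordinates
      \<open>0\<close> to \<open>2 * n\<close>.\<close>
    have "measure \<mu> (B \<inter> ?Z) = measure \<mu> (B \<inter> cylinder P 0 (int (length v) - 1) v)"
      using measure_invariant_Int_cylinder[OF B, of "- int n" n "int n" v] by (simp add: len)
    moreover have "measure \<mu> ?Z = R (length v) v"
      using cyl[of "- int n" "int n" v] True v(1) len by (simp add: nat_add_distrib nat_mult_distrib)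
    ultimately show ?thesis using measure_Int_prefix_le[OF B v] by simp
  qed
  let ?A' = "space \<mu> - A"
  have "left_shift -` ?A' \<inter> space \<mu> = ?A'"
    using left_shift_subshift inv[unfolded space_\<mu>] unfolding space_\<mu> by blast
  then have "measure \<mu> (?A' \<inter> ?Z) \<le> measure \<mu> ?A' * measure \<mu> ?Z"
    using A by (intro le) auto
  moreover have "measure \<mu> ?A' = 1 - measure \<mu> A" using A by (simp add: prob_compl)
  moreover have "measure \<mu> ?Z = measure \<mu> (A \<inter> ?Z) + measure \<mu> (?A' \<inter> ?Z)"
  proof -
    have "?Z = (A \<inter> ?Z) \<union> (?A' \<inter> ?Z)" by (auto simp: space_\<mu> cylinder_def)
    then show ?thesis
      using A finite_measure_Union[of "A \<inter> ?Z" "?A' \<inter> ?Z"] by auto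
  qed
  ultimately show ?thesis using le[OF A inv] by (simp add: algebra_simps)
qed

text \<open>Independence passes from the central cylinders to the generated sigma-algebra, which
  contains \<open>A\<close>; hence the measure of \<open>A\<close> equals its own square.\<close>

lemma invariant_trivial:
  assumes A: "A \<in> sets \<mu>" and inv: "left_shift -` A \<inter> space \<mu> = A"
  shows "measure \<mu> A = 0 \<or> measure \<mu> A = 1"
proof -
  have "indep_set {A} (central_cylinders P)"
    using A measure_Int_cylinder[OF A inv]
    by (intro indep_setI) (auto simp: central_cylinders_def simp del: of_nat_Suc)
  then have "indep_set (sigma_sets (space \<mu>) {A}) (sigma_sets (space \<mu>) (central_cylinders P))"
    by (rule indep_set_sigma_sets) (auto simp: Int_stable_central_cylinders intro: Int_stableI)
  then have "measure \<mu> (A \<inter> A) = measure \<mu> A * measure \<mu> A"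
    by (rule indep_setD) (use A in \<open>auto simp: sets_\<mu>_eq space_\<mu> intro: sigma_sets.Basic\<close>)
  then show ?thesis by simp
qed

lemma ergodic_left_shift: "ergodic \<mu> left_shift"
  unfolding ergodic_def using prob left_shift_measurable distr_left_shift invariant_trivial by blast

end

theorem theorem5p9:
  fixes P :: "'a::finite \<Rightarrow> 'a list pmf" and \<mu> :: "(int \<Rightarrow> 'a) measure"
  assumes "random_substitution P"
    and "rs_primitive P"
    and "rs_expanding P"
    and "frequency_measure P \<mu>"
  shows "ergodic \<mu> left_shift"
proof -
  obtain R where "frequency_system P \<mu> R"
    using assms unfolding frequency_measure_def frequency_system_def by blast
  then show ?thesis by (rule frequency_system.ergodic_left_shift)
qed

end
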